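(* Let $\Sigma$ be an oriented surface of negative Euler characteristic with a complete hyperbolic metric, with universal cover identified with the hyperbolic plane $\mathbb{H}$. Let $x$ and $y$ be closed directed geodesics on $\Sigma$ intersecting transversally at a point $P$. Let $\Gamma_P(x,y)$ be the directed closed piecewise geodesic that starts at $P$, goes once around $x$ and then once around $y$, and let $X$, $Y$ be the hyperbolic isometries of $\mathbb{H}$ associated to $x$ and $y$ as elements of $\pi_1(\Sigma,P)$. Then the unique closed directed geodesic in the free homotopy class of $\Gamma_P(x,y)$ (equivalently, the unique closed directed geodesic in the class of the loop product of $x$ and $y$ based at $P$) is the projection to $\Sigma$ of the axis of $X\circ Y$. Moreover, this closed geodesic intersects $x$ at $P_x$, the midpoint of $x$ with respect to $P$, and intersects $y$ at $P_y$, the midpoint of $y$ with respect to $P$.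
   Context: A choice of a lift $P'\in\mathbb{H}$ of $P$ identifies $\pi_1(\Sigma,P)$ with the group of deck transformations of $\mathbb{H}\to\Sigma$; $X$ and $Y$ are the deck transformations corresponding to the loops $x$ and $y$ based at $P$, so that the axes of $X$ and $Y$ are the lifts of $x$ and $y$ through $P'$. ($X\circ Y$ and $Y\circ X$ are conjugate, so their axes have the same projection to $\Sigma$.) The axis of a hyperbolic isometry is directed by its translation direction. For a closed geodesic $z$ of length $\ell_z$ and a point $R$ of $z$, the midpoint of $z$ with respect to $R$, denoted $R_z$, is the point of $z$ such that both arcs of $z$ from $R$ to $R_z$ have the same length; i.e. if $z:[0,\ell_z]\to\Sigma$ is the arc-length parametrization with $z(0)=z(\ell_z)=R$ (if $R$ is a multiple point of $z$, start along the branch under consideration, namely the one used in forming the loop product), then $R_z=z(\ell_z/2)$. *)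

theory Defs
  imports "HOL-Analysis.Analysis" "HOL-Homology.Homology"
begin

section \<open>The hyperbolic plane\<close>

definition hyp_plane :: "complex set" where
  "hyp_plane = {z. Im z > 0}"

text \<open>Distance of the metric (dx^2 + dy^2)/y^2, which has curvature -1.\<close>

definition hyp_dist :: "complex \<Rightarrow> complex \<Rightarrow> real" where
  "hyp_dist z w = arcosh (1 + (cmod (z - w))\<^sup>2 / (2 * Im z * Im w))"

text \<open>An isometry is orientation preserving exactly when it is conformal, i.e. holomorphic
  (the orientation-reversing ones are antiholomorphic).\<close>

definition orientation_preserving_isometry :: "(complex \<Rightarrow> complex) \<Rightarrow> bool" where
  "orientation_preserving_isometry T \<longleftrightarrow>
     bij_betw T hyp_plane hyp_plane \<and>
     (\<forall>z\<in>hyp_plane. \<forall>w\<in>hyp_plane. hyp_dist (T z) (T w) = hyp_dist z w) \<and>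
     T holomorphic_on hyp_plane"

definition geodesic_line :: "(real \<Rightarrow> complex) \<Rightarrow> bool" where
  "geodesic_line \<alpha> \<longleftrightarrow> range \<alpha> \<subseteq> hyp_plane \<and> (\<forall>s t. hyp_dist (\<alpha> s) (\<alpha> t) = \<bar>s - t\<bar>)"

text \<open>\<open>\<alpha>\<close> is a unit-speed parametrization of a line along which \<open>T\<close> translates by
  \<open>l > 0\<close>, in the direction of the translation. Such a line is unique, and \<open>\<alpha>\<close> is
  determined by \<open>T\<close> up to a shift of the parameter.\<close>

definition directed_axis :: "(complex \<Rightarrow> complex) \<Rightarrow> real \<Rightarrow> (real \<Rightarrow> complex) \<Rightarrow> bool" where
  "directed_axis T l \<alpha> \<longleftrightarrow> geodesic_line \<alpha> \<and> l > 0 \<and> (\<forall>t. T (\<alpha> t) = \<alpha> (t + l))"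

definition hyperbolic_isometry :: "(complex \<Rightarrow> complex) \<Rightarrow> bool" where
  "hyperbolic_isometry T \<longleftrightarrow>
     orientation_preserving_isometry T \<and> (\<exists>l \<alpha>. directed_axis T l \<alpha>)"


section \<open>Oriented surfaces with a complete hyperbolic metric\<close>

definition curve_length :: "(real \<Rightarrow> 'a::metric_space) \<Rightarrow> ereal" where
  "curve_length g =
     (SUP (n, t) \<in> {(n::nat, t::nat \<Rightarrow> real). mono_on {..n} t \<and> t 0 = 0 \<and> t n = 1}.
        \<Sum>i<n. ereal (dist (g (t i)) (g (t (Suc i)))))"

text \<open>The distance of a connected Riemannian manifold is the infimum of the lengths of curves.
  Since an infimum over no curves is \<open>\<infinity>\<close>, this implies that \<open>S\<close> is path connected.\<close>

definition length_metric_on :: "'a::metric_space set \<Rightarrow> bool" where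
  "length_metric_on S \<longleftrightarrow>
     (\<forall>a\<in>S. \<forall>b\<in>S. ereal (dist a b) =
        (INF g \<in> {g. path g \<and> path_image g \<subseteq> S \<and> pathstart g = a \<and> pathfinish g = b}.
           curve_length g))"

text \<open>The surface is a subset \<open>S\<close> of a metric space, with the restricted distance.
  The charts in \<open>A\<close> are isometries from open subsets \<open>U\<close> of \<open>S\<close> onto open subsets of the
  hyperbolic plane; the orientation is given by requiring the transition maps, which are local
  isometries, to preserve orientation, i.e. to be holomorphic.\<close>

definition oriented_hyperbolic_surface ::
    "'a::metric_space set \<Rightarrow> ('a set \<times> ('a \<Rightarrow> complex)) set \<Rightarrow> bool" where
  "oriented_hyperbolic_surface S A \<longleftrightarrow>
     length_metric_on S \<and>
     (\<forall>a\<in>S. \<exists>(U, \<phi>)\<in>A. a \<in> U) \<and>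
     (\<forall>(U, \<phi>)\<in>A. openin (top_of_set S) U \<and> open (\<phi> ` U) \<and> \<phi> ` U \<subseteq> hyp_plane \<and>
        (\<forall>a\<in>U. \<forall>b\<in>U. hyp_dist (\<phi> a) (\<phi> b) = dist a b)) \<and>
     (\<forall>(U, \<phi>)\<in>A. \<forall>(V, \<psi>)\<in>A. (\<lambda>w. \<psi> (inv_into U \<phi> w)) holomorphic_on \<phi> ` (U \<inter> V))"

definition universal_cover ::
    "'a::metric_space set \<Rightarrow> ('a set \<times> ('a \<Rightarrow> complex)) set \<Rightarrow> (complex \<Rightarrow> 'a) \<Rightarrow> bool" where
  "universal_cover S A p \<longleftrightarrow>
     covering_space hyp_plane p S \<and>
     (\<forall>w\<in>hyp_plane. \<exists>r>0. \<forall>u\<in>hyp_plane. \<forall>v\<in>hyp_plane.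
        hyp_dist w u < r \<and> hyp_dist w v < r \<longrightarrow> dist (p u) (p v) = hyp_dist u v) \<and>
     (\<forall>(U, \<phi>)\<in>A. (\<lambda>w. \<phi> (p w)) holomorphic_on {w \<in> hyp_plane. p w \<in> U})"

text \<open>Rank of an abelian group (written multiplicatively, as the homology groups are): the
  supremum of the sizes of its finite subsets that are linearly independent over the integers.\<close>

definition abelian_rank :: "('g, 'm) monoid_scheme \<Rightarrow> enat" where
  "abelian_rank G =
     (SUP B \<in> {B. finite B \<and> B \<subseteq> carrier G \<and>
          (\<forall>c::'g \<Rightarrow> int. finprod G (\<lambda>b. b [^]\<^bsub>G\<^esub> c b) B = \<one>\<^bsub>G\<^esub> \<longrightarrow> (\<forall>b\<in>B. c b = 0))}.
        enat (card B))"

definition betti_number :: "nat \<Rightarrow> 'a topology \<Rightarrow> enat" where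
  "betti_number k T = abelian_rank (homology_group (int k) T)"

text \<open>For a surface, homology vanishes above degree 2. A connected surface has
  Betti numbers at most 1 in degrees 0 and 2, so that no difference of infinities occurs, and
  the value is \<open>-\<infinity>\<close> when the first homology has infinite rank.\<close>

definition surface_euler_char :: "'a topology \<Rightarrow> ereal" where
  "surface_euler_char T =
     ereal_of_enat (betti_number 0 T) - ereal_of_enat (betti_number 1 T)
       + ereal_of_enat (betti_number 2 T)"


section \<open>Closed directed geodesics\<close>

text \<open>A closed directed geodesic of length \<open>l\<close>: a locally isometric map on the line with
  period \<open>l\<close> (not necessarily the least one). It may start at any of its points.\<close>

definition closed_geodesic :: "'a::metric_space set \<Rightarrow> real \<Rightarrow> (real \<Rightarrow> 'a) \<Rightarrow> bool" where
  "closed_geodesic S l z \<longleftrightarrow>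
     l > 0 \<and> range z \<subseteq> S \<and> (\<forall>t. z (t + l) = z t) \<and>
     (\<forall>t. \<exists>e>0. \<forall>s\<in>{t-e<..<t+e}. \<forall>s'\<in>{t-e<..<t+e}. dist (z s) (z s') = \<bar>s - s'\<bar>)"

definition same_closed_geodesic ::
    "real \<Rightarrow> (real \<Rightarrow> 'a) \<Rightarrow> real \<Rightarrow> (real \<Rightarrow> 'a) \<Rightarrow> bool" where
  "same_closed_geodesic l z l' z' \<longleftrightarrow> l' = l \<and> (\<exists>s. \<forall>t. z' t = z (t + s))"

definition geodesic_loop :: "real \<Rightarrow> (real \<Rightarrow> 'a) \<Rightarrow> real \<Rightarrow> 'a" where
  "geodesic_loop l z = (\<lambda>t. z (l * t))"

definition unique_closed_geodesic_in_class ::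
    "'a::metric_space set \<Rightarrow> (real \<Rightarrow> 'a) \<Rightarrow> real \<Rightarrow> (real \<Rightarrow> 'a) \<Rightarrow> bool" where
  "unique_closed_geodesic_in_class S \<gamma> l z \<longleftrightarrow>
     closed_geodesic S l z \<and> homotopic_loops S \<gamma> (geodesic_loop l z) \<and>
     (\<forall>l' z'. closed_geodesic S l' z' \<and> homotopic_loops S \<gamma> (geodesic_loop l' z') \<longrightarrow>
        same_closed_geodesic l z l' z')"

text \<open>The midpoint of a closed geodesic with respect to its starting point \<open>z 0\<close>.\<close>

definition geodesic_midpoint :: "real \<Rightarrow> (real \<Rightarrow> 'a) \<Rightarrow> 'a" where
  "geodesic_midpoint l z = z (l / 2)"

text \<open>The branches of \<open>x\<close> and \<open>y\<close> starting at the parameter 0 meet at the point \<open>P\<close>, and in a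
  chart their tangent vectors there span the tangent plane.\<close>

definition transversal_at ::
    "('a set \<times> ('a \<Rightarrow> complex)) set \<Rightarrow> (real \<Rightarrow> 'a) \<Rightarrow> (real \<Rightarrow> 'a) \<Rightarrow> 'a \<Rightarrow> bool" where
  "transversal_at A x y P \<longleftrightarrow>
     x 0 = P \<and> y 0 = P \<and>
     (\<exists>(U, \<phi>)\<in>A. P \<in> U \<and>
        (\<exists>v w. ((\<phi> \<circ> x) has_vector_derivative v) (at 0) \<and>
               ((\<phi> \<circ> y) has_vector_derivative w) (at 0) \<and>
               span {v, w} = (UNIV :: complex set)))"


section \<open>Deck transformations and the fundamental group\<close>

definition deck_transformation :: "(complex \<Rightarrow> 'a) \<Rightarrow> (complex \<Rightarrow> complex) \<Rightarrow> bool" where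
  "deck_transformation p T \<longleftrightarrow>
     (\<exists>T'. homeomorphism hyp_plane hyp_plane T T') \<and> (\<forall>w\<in>hyp_plane. p (T w) = p w)"

text \<open>\<open>T\<close> maps \<open>P'\<close> to the end point of the lift \<open>g\<close> of the loop \<open>\<gamma>\<close> that starts at \<open>P'\<close>.
  With this convention \<open>\<gamma>\<close> followed by \<open>\<delta>\<close> corresponds to \<open>T\<^sub>\<gamma> \<circ> T\<^sub>\<delta>\<close>.\<close>

definition deck_transformation_of_loop ::
    "(complex \<Rightarrow> 'a) \<Rightarrow> complex \<Rightarrow> (real \<Rightarrow> 'a) \<Rightarrow> (complex \<Rightarrow> complex) \<Rightarrow> bool" where
  "deck_transformation_of_loop p P' \<gamma> T \<longleftrightarrow>
     deck_transformation p T \<and>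
     (\<exists>g. path g \<and> path_image g \<subseteq> hyp_plane \<and> pathstart g = P' \<and>
        (\<forall>t\<in>{0..1}. p (g t) = \<gamma> t) \<and> T P' = pathfinish g)"

end

theory Submission
  imports Defs "HOL-Complex_Analysis.Conformal_Mappings"
begin

text \<open>Lift \<open>x\<close> and \<open>y\<close> to the axes of \<open>X\<close> and \<open>Y\<close> through \<open>P'\<close>. The translation \<open>X\<close> is the half-turn
  about \<open>P'\<close> followed by the half-turn about the lift of \<open>P\<^sub>x\<close> at distance \<open>lx / 2\<close> ahead of \<open>P'\<close>, and
  \<open>Y\<close> is the half-turn about the lift of \<open>P\<^sub>y\<close> at distance \<open>ly / 2\<close> behind \<open>P'\<close> followed by the
  half-turn about \<open>P'\<close>. Hence \<open>X \<circ> Y\<close> is the product of the half-turns about these two midpoints,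
  that is, a translation along the line through them; the midpoints are distinct by transversality.
  A closed geodesic in the class of the loop lifts to an axis of \<open>X \<circ> Y\<close>, and a translation has
  only one axis, because its displacement is minimal exactly there.\<close>

section \<open>The hyperboloid model\<close>

text \<open>The half-turn decompositions of \<open>X\<close> and \<open>Y\<close> are checked on
  their axes alone, where composing with the reflection in the axis changes nothing; orientation is
  what excludes the reflected map. Since \<open>deck_transformation\<close> is a topological notion,
  isometry and holomorphy have to be derived from the covering; the identity theorem then carries
  agreement from the axis to the whole plane. Geodesics are likewise given only metrically. The
  hyperboloid turns all this into linear algebra: the form is the \<open>cosh\<close> of the
  distance, a unit-speed line is a combination of two fixed vectors with coefficients
  \<open>cosh t\<close> and \<open>sinh t\<close>, and a half-turn is a linear involution. The two
  half-turns about \<open>P'\<close> must be adjacent in \<open>X \<circ> Y\<close>; hence one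
  midpoint lies ahead of \<open>P'\<close> and the other behind. The latter still projects to
  \<open>P\<^sub>y\<close>, because \<open>y\<close> has period \<open>ly\<close>. The midpoints lie
  at distances \<open>lx / 2\<close> and \<open>ly / 2\<close> from \<open>P'\<close>, so they
  coincide only if \<open>y\<close> is \<open>x\<close> run backwards, in which case
  \<open>X \<circ> Y\<close> would be the identity; transversality excludes this.\<close>

text \<open>A vector \<open>(a, b, c)\<close> stands for the symmetric matrix \<open>[[a, b], [b, c]]\<close> and the form is
  the polarization of the determinant. The point \<open>z = g \<i>\<close> of the half-plane, with \<open>g\<close> in \<open>SL(2)\<close>, is
  represented by \<open>g g\<^sup>T\<close>.\<close>

definition lorentz :: "real \<times> real \<times> real \<Rightarrow> real \<times> real \<times> real \<Rightarrow> real" where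
  "lorentz u v = (fst u * snd (snd v) + snd (snd u) * fst v) / 2 - fst (snd u) * fst (snd v)"

definition hyperboloid :: "(real \<times> real \<times> real) set" where
  "hyperboloid = {u. lorentz u u = 1 \<and> snd (snd u) > 0}"

definition emb :: "complex \<Rightarrow> real \<times> real \<times> real" where
  "emb z = (((Re z)\<^sup>2 + (Im z)\<^sup>2) / Im z, Re z / Im z, 1 / Im z)"

definition unemb :: "real \<times> real \<times> real \<Rightarrow> complex" where
  "unemb u = Complex (fst (snd u) / snd (snd u)) (1 / snd (snd u))"

lemma lorentz_add_left: "lorentz (u + v) w = lorentz u w + lorentz v w"
  and lorentz_add_right: "lorentz w (u + v) = lorentz w u + lorentz w v"
  and lorentz_diff_left: "lorentz (u - v) w = lorentz u w - lorentz v w"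
  and lorentz_diff_right: "lorentz w (u - v) = lorentz w u - lorentz w v"
  and lorentz_scale_left: "lorentz (c *\<^sub>R u) w = c * lorentz u w"
  and lorentz_scale_right: "lorentz w (c *\<^sub>R u) = c * lorentz w u"
  by (simp_all add: lorentz_def field_simps)

lemmas lorentz_linear = lorentz_add_left lorentz_add_right lorentz_diff_left lorentz_diff_right
  lorentz_scale_left lorentz_scale_right

lemma lorentz_commute: "lorentz u v = lorentz v u"
  by (simp add: lorentz_def algebra_simps)

lemma emb_in_hyperboloid: "z \<in> hyp_plane \<Longrightarrow> emb z \<in> hyperboloid"
  by (auto simp: hyp_plane_def emb_def hyperboloid_def lorentz_def field_simps power2_eq_square)

lemma unemb_emb: "z \<in> hyp_plane \<Longrightarrow> unemb (emb z) = z"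
  by (auto simp: hyp_plane_def emb_def unemb_def complex_eq_iff)

lemma unemb_in_hyp_plane: "u \<in> hyperboloid \<Longrightarrow> unemb u \<in> hyp_plane"
  by (auto simp: hyp_plane_def unemb_def hyperboloid_def)

lemma emb_unemb:
  assumes "u \<in> hyperboloid"
  shows "emb (unemb u) = u"
proof -
  obtain a b c where u: "u = (a, b, c)" by (metis prod.exhaust)
  have "a * c - b * b = 1" "c > 0"
    using assms by (auto simp: u hyperboloid_def lorentz_def field_simps)
  then have "(b * b + 1) / c = a"
    by (auto simp: field_simps)
  then show ?thesis
    using \<open>c > 0\<close>
    by (auto simp: u emb_def unemb_def field_simps power2_eq_square)
qed

lemma emb_inject: "z \<in> hyp_plane \<Longrightarrow> w \<in> hyp_plane \<Longrightarrow> emb z = emb w \<longleftrightarrow> z = w"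
  by (metis unemb_emb)

lemma lorentz_emb_self: "z \<in> hyp_plane \<Longrightarrow> lorentz (emb z) (emb z) = 1"
  using emb_in_hyperboloid by (auto simp: hyperboloid_def)

lemma lorentz_emb:
  assumes "z \<in> hyp_plane" "w \<in> hyp_plane"
  shows "lorentz (emb z) (emb w) = 1 + (cmod (z - w))\<^sup>2 / (2 * Im z * Im w)"
  using assms unfolding cmod_power2
  by (simp add: lorentz_def emb_def hyp_plane_def field_simps power2_eq_square)

lemma lorentz_emb_ge_1:
  assumes "z \<in> hyp_plane" "w \<in> hyp_plane"
  shows "lorentz (emb z) (emb w) \<ge> 1"
  using assms by (simp add: lorentz_emb hyp_plane_def)

lemma hyp_dist_lorentz:
  assumes "z \<in> hyp_plane" "w \<in> hyp_plane"
  shows "hyp_dist z w = arcosh (lorentz (emb z) (emb w))"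
  using assms by (simp add: hyp_dist_def lorentz_emb)

lemma cosh_hyp_dist:
  assumes "z \<in> hyp_plane" "w \<in> hyp_plane"
  shows "cosh (hyp_dist z w) = lorentz (emb z) (emb w)"
  using assms by (simp add: hyp_dist_lorentz lorentz_emb_ge_1)

text \<open>The bridge from metric to algebra: \<open>cosh\<close> is even, so differences of
  parameters can be inserted without regard to their sign.\<close>

lemma hyp_dist_eq_abs_iff:
  assumes "z \<in> hyp_plane" "w \<in> hyp_plane"
  shows "hyp_dist z w = \<bar>r\<bar> \<longleftrightarrow> lorentz (emb z) (emb w) = cosh r"
proof
  assume "hyp_dist z w = \<bar>r\<bar>"
  then show "lorentz (emb z) (emb w) = cosh r"
    using cosh_hyp_dist[OF assms] by simp
next
  assume *: "lorentz (emb z) (emb w) = cosh r"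
  show "hyp_dist z w = \<bar>r\<bar>"
    using assms arcosh_cosh_real[of "\<bar>r\<bar>"] by (simp add: hyp_dist_lorentz *)
qed

lemma hyp_dist_nonneg:
  assumes "z \<in> hyp_plane" "w \<in> hyp_plane"
  shows "hyp_dist z w \<ge> 0"
  using assms by (simp add: hyp_dist_lorentz lorentz_emb_ge_1)

lemma hyp_dist_eq_0_iff:
  assumes "z \<in> hyp_plane" "w \<in> hyp_plane"
  shows "hyp_dist z w = 0 \<longleftrightarrow> z = w"
  using hyp_dist_eq_abs_iff[OF assms, of 0] assms by (auto simp: lorentz_emb hyp_plane_def)

lemma hyp_dist_self: "z \<in> hyp_plane \<Longrightarrow> hyp_dist z z = 0"
  by (simp add: hyp_dist_eq_0_iff)

section \<open>Topology of the half-plane\<close>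

lemma open_hyp_plane: "open hyp_plane"
  unfolding hyp_plane_def by (rule open_halfspace_Im_gt)

lemma convex_hyp_plane: "convex hyp_plane"
  unfolding hyp_plane_def by (rule convex_halfspace_Im_gt)

lemma continuous_on_unemb: "continuous_on hyperboloid unemb"
proof -
  have "unemb = (\<lambda>u. of_real (fst (snd u) / snd (snd u)) + \<i> * of_real (1 / snd (snd u)))"
    by (auto simp: unemb_def complex_eq_iff)
  moreover have "continuous_on hyperboloid
      (\<lambda>u. of_real (fst (snd u) / snd (snd u)) + \<i> * of_real (1 / snd (snd u)))"
    by (intro continuous_intros) (auto simp: hyperboloid_def)
  ultimately show ?thesis by metis
qed

text \<open>Hyperbolic balls are Euclidean neighbourhoods because \<open>hyp_dist w\<close> is
  continuous; this turns the radius in \<open>universal_cover\<close> into an open set.\<close>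

lemma eventually_hyp_dist_less:
  assumes "w \<in> hyp_plane" "r > 0"
  shows "eventually (\<lambda>u. u \<in> hyp_plane \<and> hyp_dist w u < r) (nhds w)"
proof -
  have "continuous_on hyp_plane (\<lambda>u. arcosh (1 + (cmod (w - u))\<^sup>2 / (2 * Im w * Im u)))"
    by (intro continuous_on_compose2[OF continuous_on_arcosh[OF order_refl]] continuous_intros)
       (use assms in \<open>auto simp: hyp_plane_def\<close>)
  then have "continuous_on hyp_plane (hyp_dist w)"
    unfolding hyp_dist_def .
  then have "isCont (hyp_dist w) w"
    using assms open_hyp_plane continuous_on_eq_continuous_at by blast
  then have "(hyp_dist w \<longlongrightarrow> 0) (nhds w)"
    using isContD[of w "hyp_dist w"] tendsto_at_iff_tendsto_nhds[of "hyp_dist w" w]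
    by (simp add: hyp_dist_self[OF assms(1)])
  then have "eventually (\<lambda>u. hyp_dist w u < r) (nhds w)"
    using assms(2) order_tendstoD(2) by blast
  moreover have "eventually (\<lambda>u. u \<in> hyp_plane) (nhds w)"
    using assms open_hyp_plane eventually_nhds_in_open by blast
  ultimately show ?thesis by (simp add: eventually_conj_iff)
qed

text \<open>The orthogonal complement of a timelike vector is negative definite.\<close>

lemma lorentz_orthogonal_null:
  assumes "u \<in> hyperboloid" "lorentz u w = 0" "lorentz w w = 0"
  shows "w = 0"
proof -
  obtain a b c where u: "u = (a, b, c)" by (metis prod.exhaust)
  obtain x y z where w: "w = (x, y, z)" by (metis prod.exhaust)
  have 1: "a * c - b * b = 1" "c > 0" and 2: "a * z + c * x = 2 * b * y" and 3: "x * z = y * y"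
    using assms by (auto simp: u w hyperboloid_def lorentz_def field_simps)
  have "(b * z - c * y)\<^sup>2 + z\<^sup>2 = (b * b + 1) * z * z - 2 * b * y * (c * z) + c * c * (y * y)"
    by (simp add: power2_eq_square algebra_simps)
  also have "\<dots> = a * c * z * z - (a * z + c * x) * (c * z) + c * c * (x * z)"
    using 1 2 3 by (simp add: algebra_simps)
  also have "\<dots> = 0" by (simp add: algebra_simps)
  finally have "(b * z - c * y)\<^sup>2 + z\<^sup>2 = 0" .
  then have "z = 0" "c * y = 0" by (auto simp: sum_power2_eq_zero_iff)
  with 1 2 have "z = 0" "y = 0" "x = 0" by auto
  then show ?thesis by (simp add: w zero_prod_def)
qed

section \<open>Geodesics as curves with coefficients \<open>cosh\<close> and
  \<open>sinh\<close>\<close>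

lemma hyperboloid_isometric_points:
  assumes u: "u \<in> hyperboloid" and v: "v \<in> hyperboloid" and w: "w \<in> hyperboloid"
    and uv: "lorentz u v = cosh (b - a)" and uw: "lorentz u w = cosh (t - a)"
    and vw: "lorentz v w = cosh (b - t)"
  shows "sinh (b - a) *\<^sub>R w = sinh (b - t) *\<^sub>R u + sinh (t - a) *\<^sub>R v"
proof -
  define p q where "p = b - t" and "q = t - a"
  have ba: "b - a = p + q" by (simp add: p_def q_def)
  \<comment> \<open>The defect of the claimed identity is a combination of \<open>u\<close>,
    \<open>v\<close>, \<open>w\<close> and turns out to be orthogonal to all three. So it is null
    and orthogonal to a timelike vector, hence zero. No order of \<open>a\<close>, \<open>b\<close>,
    \<open>t\<close> is assumed.\<close>
  define d where "d = sinh (p + q) *\<^sub>R w - sinh p *\<^sub>R u - sinh q *\<^sub>R v"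
  have uu: "lorentz u u = 1" "lorentz v v = 1" "lorentz w w = 1"
    using u v w by (auto simp: hyperboloid_def)
  note sym = lorentz_commute[of w u] lorentz_commute[of v u] lorentz_commute[of w v]
  have sp: "sinh p = sinh (p + q) * cosh q - cosh (p + q) * sinh q"
    using sinh_diff[of "p + q" q] by simp
  have sq: "sinh q = sinh (p + q) * cosh p - cosh (p + q) * sinh p"
    using sinh_diff[of "p + q" p] by simp
  have 1: "lorentz u d = 0"
    using uv uw uu sp by (simp add: d_def lorentz_linear ba p_def[symmetric] q_def[symmetric])
  have 2: "lorentz v d = 0"
    using uv vw uu sq by (simp add: d_def lorentz_linear ba p_def[symmetric] q_def[symmetric] sym)
  have 3: "lorentz w d = 0"
    using uw vw uu sinh_add[of p q]
    by (simp add: d_def lorentz_linear ba p_def[symmetric] q_def[symmetric] sym)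
  have "lorentz d d = sinh (p + q) * lorentz w d - sinh p * lorentz u d - sinh q * lorentz v d"
    by (subst (1) d_def) (simp add: lorentz_linear)
  then have "d = 0"
    using lorentz_orthogonal_null[OF u 1] 1 2 3 by simp
  then show ?thesis
    by (simp add: d_def ba p_def[symmetric] q_def[symmetric] algebra_simps)
qed

text \<open>The linear system for the two coefficient vectors has determinant
  \<open>sinh (t - s)\<close>, which vanishes only for equal parameters.\<close>

lemma cosh_sinh_coeff_unique:
  fixes U V U' V' :: "'b::real_vector"
  assumes "cosh s *\<^sub>R U + sinh s *\<^sub>R V = cosh s *\<^sub>R U' + sinh s *\<^sub>R V'"
    and "cosh t *\<^sub>R U + sinh t *\<^sub>R V = cosh t *\<^sub>R U' + sinh t *\<^sub>R V'" and "s \<noteq> (t::real)"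
  shows "U = U'" "V = V'"
proof -
  have s: "cosh s *\<^sub>R (U - U') + sinh s *\<^sub>R (V - V') = 0"
    and t: "cosh t *\<^sub>R (U - U') + sinh t *\<^sub>R (V - V') = 0"
    using assms by (simp_all add: algebra_simps)
  have "sinh t *\<^sub>R (cosh s *\<^sub>R (U - U') + sinh s *\<^sub>R (V - V'))
      - sinh s *\<^sub>R (cosh t *\<^sub>R (U - U') + sinh t *\<^sub>R (V - V'))
      = sinh (t - s) *\<^sub>R (U - U')"
    by (simp add: sinh_diff algebra_simps)
  with s t \<open>s \<noteq> t\<close> show "U = U'" by simp
  have "cosh s *\<^sub>R (cosh t *\<^sub>R (U - U') + sinh t *\<^sub>R (V - V'))
      - cosh t *\<^sub>R (cosh s *\<^sub>R (U - U') + sinh s *\<^sub>R (V - V'))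
      = sinh (t - s) *\<^sub>R (V - V')"
    by (simp add: sinh_diff algebra_simps)
  with s t \<open>s \<noteq> t\<close> show "V = V'" by simp
qed

text \<open>Two parameters \<open>a\<close> and \<open>b\<close> determine the curve by
  interpolation; \<open>U\<close> and \<open>V\<close> collect the coefficients of
  \<open>cosh t\<close> and \<open>sinh t\<close> after expanding \<open>sinh (b - t)\<close> and
  \<open>sinh (t - a)\<close>. The set \<open>I\<close> is arbitrary, so the result serves both
  whole lines and short intervals.\<close>

lemma isometric_on_imp_cosh_sinh:
  assumes I: "a \<in> I" "b \<in> I" "a \<noteq> b" and \<alpha>: "\<alpha> ` I \<subseteq> hyp_plane"
    and iso: "\<And>s t. s \<in> I \<Longrightarrow> t \<in> I \<Longrightarrow> hyp_dist (\<alpha> s) (\<alpha> t) = \<bar>s - t\<bar>"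
  obtains U V where "\<And>t. t \<in> I \<Longrightarrow> emb (\<alpha> t) = cosh t *\<^sub>R U + sinh t *\<^sub>R V"
proof -
  define U where "U = (sinh b / sinh (b - a)) *\<^sub>R emb (\<alpha> a) - (sinh a / sinh (b - a)) *\<^sub>R emb (\<alpha> b)"
  define V where "V = (cosh a / sinh (b - a)) *\<^sub>R emb (\<alpha> b) - (cosh b / sinh (b - a)) *\<^sub>R emb (\<alpha> a)"
  have nz: "sinh (b - a) \<noteq> 0" using I by simp
  have "emb (\<alpha> t) = cosh t *\<^sub>R U + sinh t *\<^sub>R V" if t: "t \<in> I" for t
  proof -
    have H: "\<alpha> a \<in> hyp_plane" "\<alpha> b \<in> hyp_plane" "\<alpha> t \<in> hyp_plane"
      using I \<alpha> t by auto
    have "sinh (b - a) *\<^sub>R emb (\<alpha> t) = sinh (b - t) *\<^sub>R emb (\<alpha> a) + sinh (t - a) *\<^sub>R emb (\<alpha> b)"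
    proof (rule hyperboloid_isometric_points)
      show "lorentz (emb (\<alpha> a)) (emb (\<alpha> b)) = cosh (b - a)"
        using iso[of b a] I hyp_dist_eq_abs_iff[OF H(2,1)] by (simp add: lorentz_commute)
      show "lorentz (emb (\<alpha> a)) (emb (\<alpha> t)) = cosh (t - a)"
        using iso[of t a] I t hyp_dist_eq_abs_iff[OF H(3,1)] by (simp add: lorentz_commute)
      show "lorentz (emb (\<alpha> b)) (emb (\<alpha> t)) = cosh (b - t)"
        using iso[of b t] I t hyp_dist_eq_abs_iff[OF H(2,3)] by simp
    qed (use H emb_in_hyperboloid in auto)
    also have "\<dots> = sinh (b - a) *\<^sub>R (cosh t *\<^sub>R U + sinh t *\<^sub>R V)"
      using nz by (simp add: U_def V_def scaleR_add_right scaleR_diff_right) (simp add: sinh_diff algebra_simps)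
    finally show ?thesis using nz by simp
  qed
  then show ?thesis using that by blast
qed

lemma lorentz_cosh_sinh:
  "lorentz (cosh s *\<^sub>R U + sinh s *\<^sub>R V) (cosh t *\<^sub>R U + sinh t *\<^sub>R V)
     = cosh s * cosh t * lorentz U U + (cosh s * sinh t + sinh s * cosh t) * lorentz U V
       + sinh s * sinh t * lorentz V V"
  by (simp add: lorentz_linear lorentz_commute[of V U] algebra_simps)

lemma lorentz_frame:
  assumes "lorentz U U = 1" "lorentz U V = 0" "lorentz V V = -1"
  shows "lorentz (cosh s *\<^sub>R U + sinh s *\<^sub>R V) (cosh t *\<^sub>R U + sinh t *\<^sub>R V) = cosh (s - t)"
  unfolding lorentz_cosh_sinh using assms by (simp add: cosh_diff)

lemma geodesic_lineI:
  assumes H: "range \<alpha> \<subseteq> hyp_plane" and f: "lorentz U U = 1" "lorentz U V = 0" "lorentz V V = -1"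
    and \<alpha>: "\<And>t. emb (\<alpha> t) = cosh t *\<^sub>R U + sinh t *\<^sub>R V"
  shows "geodesic_line \<alpha>"
  unfolding geodesic_line_def
proof (intro conjI allI H)
  fix s t
  show "hyp_dist (\<alpha> s) (\<alpha> t) = \<bar>s - t\<bar>"
    using H lorentz_frame[OF f, of s t] by (subst hyp_dist_eq_abs_iff) (auto simp: \<alpha>)
qed

text \<open>\<open>V\<close> is the unit tangent vector at parameter 0; it has norm -1 because
  directions tangent to the hyperboloid are spacelike and the form is positive on timelike
  vectors.\<close>

lemma geodesic_lineE:
  assumes "geodesic_line \<alpha>"
  obtains V where "lorentz (emb (\<alpha> 0)) V = 0" "lorentz V V = -1"
    "\<And>t. emb (\<alpha> t) = cosh t *\<^sub>R emb (\<alpha> 0) + sinh t *\<^sub>R V"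
proof -
  have H: "\<And>t. \<alpha> t \<in> hyp_plane" and iso: "\<And>s t. hyp_dist (\<alpha> s) (\<alpha> t) = \<bar>s - t\<bar>"
    using assms by (auto simp: geodesic_line_def)
  obtain U V where UV: "\<And>t. t \<in> UNIV \<Longrightarrow> emb (\<alpha> t) = cosh t *\<^sub>R U + sinh t *\<^sub>R V"
    by (rule isometric_on_imp_cosh_sinh[of 0 UNIV 1 \<alpha>]) (use H iso in auto)
  have U: "U = emb (\<alpha> 0)" using UV[of 0] by simp
  have L: "lorentz (emb (\<alpha> s)) (emb (\<alpha> t)) = cosh (s - t)" for s t
    using hyp_dist_eq_abs_iff[OF H H] iso by blast
  have UU: "lorentz U U = 1" using L[of 0 0] by (simp add: U)
  \<comment> \<open>The pairs of parameters (0, 1) and (1, 1), compared with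
    \<open>cosh (s - t)\<close>, give the two remaining products of the frame.\<close>
  have "lorentz U (cosh 1 *\<^sub>R U + sinh 1 *\<^sub>R V) = cosh (1::real)"
    using L[of 0 1] UV[of 1] by (simp add: U)
  then have UV0: "lorentz U V = 0"
    using UU by (simp add: lorentz_linear)
  have "lorentz (cosh 1 *\<^sub>R U + sinh 1 *\<^sub>R V) (cosh 1 *\<^sub>R U + sinh 1 *\<^sub>R V) = 1"
    using L[of 1 1] UV[of 1] by simp
  then have "cosh 1 * cosh 1 + sinh 1 * sinh 1 * lorentz V V = (1::real)"
    unfolding lorentz_cosh_sinh using UU UV0 by simp
  then have "sinh 1 * sinh 1 * (lorentz V V + 1) = (1::real) - (cosh 1 * cosh 1 - sinh 1 * sinh 1)"
    by (simp add: algebra_simps)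
  also have "\<dots> = 0" using cosh_diff[of 1 "1::real"] by simp
  finally have VV: "lorentz V V = -1" by simp
  show ?thesis
  proof (rule that)
    show "lorentz (emb (\<alpha> 0)) V = 0" using UV0 unfolding U .
    show "lorentz V V = -1" by (rule VV)
    show "emb (\<alpha> t) = cosh t *\<^sub>R emb (\<alpha> 0) + sinh t *\<^sub>R V" for t
      using UV[OF UNIV_I, of t] unfolding U .
  qed
qed

lemma geodesic_line_hyp_plane: "geodesic_line \<alpha> \<Longrightarrow> \<alpha> t \<in> hyp_plane"
  by (auto simp: geodesic_line_def)

lemma geodesic_line_dist: "geodesic_line \<alpha> \<Longrightarrow> hyp_dist (\<alpha> s) (\<alpha> t) = \<bar>s - t\<bar>"
  by (auto simp: geodesic_line_def)

lemma geodesic_line_shift: "geodesic_line \<alpha> \<Longrightarrow> geodesic_line (\<lambda>t. \<alpha> (t + c))"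
  by (auto simp: geodesic_line_def)

lemma geodesic_line_reverse: "geodesic_line \<alpha> \<Longrightarrow> geodesic_line (\<lambda>t. \<alpha> (- t))"
  by (auto simp: geodesic_line_def)

lemma continuous_on_geodesic_line:
  assumes "geodesic_line \<alpha>"
  shows "continuous_on T \<alpha>"
proof -
  obtain V where V: "\<And>t. emb (\<alpha> t) = cosh t *\<^sub>R emb (\<alpha> 0) + sinh t *\<^sub>R V"
    using geodesic_lineE[OF assms] by metis
  have "(\<lambda>t. emb (\<alpha> t)) = (\<lambda>t. cosh t *\<^sub>R emb (\<alpha> 0) + sinh t *\<^sub>R V)"
    by (rule ext) (rule V)
  moreover have "continuous_on T (\<lambda>t. cosh t *\<^sub>R emb (\<alpha> 0) + sinh t *\<^sub>R V)"
    by (intro continuous_intros)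
  ultimately have "continuous_on T (\<lambda>t. emb (\<alpha> t))"
    by (simp only:)
  then have "continuous_on T (\<lambda>t. unemb (emb (\<alpha> t)))"
    by (rule continuous_on_compose2[OF continuous_on_unemb])
       (use assms emb_in_hyperboloid geodesic_line_hyp_plane in blast)
  then show ?thesis
    using assms by (simp add: unemb_emb geodesic_line_hyp_plane)
qed

lemma geodesic_line_unique:
  assumes "geodesic_line \<alpha>" "geodesic_line \<beta>" "\<alpha> a = \<beta> a" "\<alpha> b = \<beta> b" "a \<noteq> b"
  shows "\<alpha> = \<beta>"
proof
  fix t
  obtain V where V: "\<And>t. emb (\<alpha> t) = cosh t *\<^sub>R emb (\<alpha> 0) + sinh t *\<^sub>R V"
    using geodesic_lineE[OF assms(1)] by metis
  obtain V' where V': "\<And>t. emb (\<beta> t) = cosh t *\<^sub>R emb (\<beta> 0) + sinh t *\<^sub>R V'"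
    using geodesic_lineE[OF assms(2)] by metis
  have "emb (\<alpha> 0) = emb (\<beta> 0)" "V = V'"
    using cosh_sinh_coeff_unique[of a "emb (\<alpha> 0)" V "emb (\<beta> 0)" V' b] V V' assms by metis+
  then have "emb (\<alpha> t) = emb (\<beta> t)" by (metis V V')
  then show "\<alpha> t = \<beta> t"
    using emb_inject assms(1,2) geodesic_line_hyp_plane by blast
qed

text \<open>Near each parameter the curve has a unique pair of coefficients. The pair is therefore
  locally constant in the parameter, and connectedness of the real line makes it one pair for the
  whole curve. This is what makes lifts and deck transformations tractable: both are controlled only
  locally.\<close>

lemma locally_geodesic_imp_geodesic_line:
  assumes H: "range \<alpha> \<subseteq> hyp_plane"
    and loc: "\<And>t. \<exists>e>0. \<forall>s\<in>{t-e<..<t+e}. \<forall>s'\<in>{t-e<..<t+e}. hyp_dist (\<alpha> s) (\<alpha> s') = \<bar>s - s'\<bar>"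
  shows "geodesic_line \<alpha>"
proof -
  define Q where "Q t UV \<longleftrightarrow>
    eventually (\<lambda>s. emb (\<alpha> s) = cosh s *\<^sub>R fst UV + sinh s *\<^sub>R snd UV) (nhds t)" for t UV
  have ex: "\<exists>UV. Q t UV" for t
  proof -
    obtain e where e: "e > 0" "\<forall>s\<in>{t-e<..<t+e}. \<forall>s'\<in>{t-e<..<t+e}. hyp_dist (\<alpha> s) (\<alpha> s') = \<bar>s - s'\<bar>"
      using loc by blast
    obtain U V where UV: "\<And>s. s \<in> {t-e<..<t+e} \<Longrightarrow> emb (\<alpha> s) = cosh s *\<^sub>R U + sinh s *\<^sub>R V"
      by (rule isometric_on_imp_cosh_sinh[of t "{t-e<..<t+e}" "t + e/2" \<alpha>])
         (use e H in auto)
    have "eventually (\<lambda>s. s \<in> {t-e<..<t+e}) (nhds t)"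
      using e by (intro eventually_nhds_in_open) auto
    then have "Q t (U, V)"
      unfolding Q_def by eventually_elim (simp add: UV)
    then show ?thesis by blast
  qed
  have uniq: "UV = UV'" if "Q t UV" "Q t UV'" for t UV UV'
  proof -
    have "eventually (\<lambda>s. cosh s *\<^sub>R fst UV + sinh s *\<^sub>R snd UV
            = cosh s *\<^sub>R fst UV' + sinh s *\<^sub>R snd UV') (nhds t)"
      using that[unfolded Q_def] by eventually_elim simp
    then obtain e where e: "e > 0" "\<And>s. dist s t < e \<Longrightarrow> cosh s *\<^sub>R fst UV + sinh s *\<^sub>R snd UV
            = cosh s *\<^sub>R fst UV' + sinh s *\<^sub>R snd UV'"
      by (auto simp: eventually_nhds_metric)
    show ?thesis
      using cosh_sinh_coeff_unique[OF e(2)[of t] e(2)[of "t + e/2"]] e(1)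
      by (simp add: dist_real_def prod_eq_iff)
  qed
  \<comment> \<open>The pair valid near \<open>t\<close>. An identity that holds near
    \<open>t\<close> also holds near every point close to \<open>t\<close>, so uniqueness makes
    \<open>f\<close> locally constant.\<close>
  define f where "f t = (THE UV. Q t UV)" for t
  have Qf: "Q t (f t)" for t
    unfolding f_def using ex uniq by (metis theI)
  have "f s = f t" for s t
  proof (rule connected_local_const[where A = UNIV and f = f])
    show "\<forall>a\<in>UNIV. \<forall>\<^sub>F b in at a. f a = f b"
    proof
      fix a
      have "eventually (\<lambda>b. Q b (f a)) (nhds a)"
        using Qf[of a] unfolding Q_def by (subst eventually_eventually)
      then have "eventually (\<lambda>b. f a = f b) (nhds a)"
        by eventually_elim (use uniq Qf in blast)
      then show "\<forall>\<^sub>F b in at a. f a = f b"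
        by (simp add: eventually_nhds_conv_at)
    qed
  qed auto
  then obtain UV where UV: "\<And>t. f t = UV" by metis
  define U V where "U = fst UV" and "V = snd UV"
  have \<alpha>: "emb (\<alpha> t) = cosh t *\<^sub>R U + sinh t *\<^sub>R V" for t
  proof -
    have "Q t UV" using Qf[of t] UV by simp
    then show ?thesis unfolding Q_def U_def V_def by (rule eventually_nhds_x_imp_x)
  qed
  obtain e where e: "e > 0" "\<forall>s\<in>{0-e<..<0+e}. \<forall>s'\<in>{0-e<..<0+e}. hyp_dist (\<alpha> s) (\<alpha> s') = \<bar>s - s'\<bar>"
    using loc by blast
  define r where "r = e / 2"
  have r: "r > 0" "r < e" using e by (auto simp: r_def)
  have L: "lorentz (emb (\<alpha> s)) (emb (\<alpha> t)) = cosh (s - t)" if "\<bar>s\<bar> < e" "\<bar>t\<bar> < e" for s t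
  proof -
    have "s \<in> {0-e<..<0+e}" "t \<in> {0-e<..<0+e}" using that by auto
    then have "hyp_dist (\<alpha> s) (\<alpha> t) = \<bar>s - t\<bar>" using e(2) by blast
    moreover have "\<alpha> s \<in> hyp_plane" "\<alpha> t \<in> hyp_plane" using H by auto
    ultimately show ?thesis by (simp add: hyp_dist_eq_abs_iff)
  qed
  have UU: "lorentz U U = 1" using L[of 0 0] e by (simp add: \<alpha>)
  have "lorentz U (cosh r *\<^sub>R U + sinh r *\<^sub>R V) = cosh r"
    using L[of 0 r] r by (simp add: \<alpha>)
  then have UV0: "lorentz U V = 0"
    using UU r by (simp add: lorentz_linear)
  have "cosh r * cosh r + sinh r * sinh r * lorentz V V = 1"
    using L[of r r] r UU UV0 unfolding \<alpha> lorentz_cosh_sinh by simp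
  then have "sinh r * sinh r * (lorentz V V + 1) = 1 - (cosh r * cosh r - sinh r * sinh r)"
    by (simp add: algebra_simps)
  also have "\<dots> = 0" using cosh_diff[of r r] by simp
  finally have "lorentz V V = -1" using r by simp
  then show ?thesis
    using geodesic_lineI[OF H UU UV0 _ \<alpha>] by blast
qed

text \<open>Norm 1 alone does not select the sheet. The last coordinate never vanishes on the curve,
  since the norm would then be minus a square; being positive at 0 it stays positive by the
  intermediate value theorem.\<close>

lemma frame_in_hyperboloid:
  assumes "u \<in> hyperboloid" and UV: "lorentz u v = 0" "lorentz v v = -1"
  shows "cosh t *\<^sub>R u + sinh t *\<^sub>R v \<in> hyperboloid"
proof -
  define w where "w t = cosh t *\<^sub>R u + sinh t *\<^sub>R v" for t
  have u: "lorentz u u = 1" "snd (snd u) > 0" using assms by (auto simp: hyperboloid_def)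
  have 1: "lorentz (w s) (w s) = 1" for s
    using lorentz_frame[OF u(1) UV, of s s] by (simp add: w_def)
  have nz: "snd (snd (w s)) \<noteq> 0" for s
  proof
    assume "snd (snd (w s)) = 0"
    then have "lorentz (w s) (w s) = - (fst (snd (w s)))\<^sup>2"
      by (simp add: lorentz_def power2_eq_square)
    also have "\<dots> \<le> 0" by simp
    finally show False using 1[of s] by simp
  qed
  have pos: "snd (snd (w 0)) > 0" using u by (simp add: w_def)
  have "snd (snd (w t)) > 0"
  proof (rule ccontr)
    assume "\<not> snd (snd (w t)) > 0"
    then have le: "snd (snd (w t)) \<le> 0" by simp
    have conn: "connected (range (\<lambda>s. snd (snd (w s))))"
      unfolding w_def by (intro connected_continuous_image continuous_intros connected_UNIV)
    have "0 \<in> range (\<lambda>s. snd (snd (w s)))"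
      using connectedD_interval[OF conn, of "snd (snd (w t))" "snd (snd (w 0))" 0] pos le by auto
    then obtain s where "0 = snd (snd (w s))" by (rule rangeE)
    then show False using nz[of s] by simp
  qed
  with 1 show ?thesis by (simp add: hyperboloid_def w_def)
qed

lemma geodesic_line_frame:
  assumes "u \<in> hyperboloid" "lorentz u v = 0" "lorentz v v = -1"
  shows "geodesic_line (\<lambda>t. unemb (cosh t *\<^sub>R u + sinh t *\<^sub>R v))"
proof (rule geodesic_lineI)
  show "range (\<lambda>t. unemb (cosh t *\<^sub>R u + sinh t *\<^sub>R v)) \<subseteq> hyp_plane"
    using frame_in_hyperboloid[OF assms] unemb_in_hyp_plane by blast
  show "emb (unemb (cosh t *\<^sub>R u + sinh t *\<^sub>R v)) = cosh t *\<^sub>R u + sinh t *\<^sub>R v" for t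
    using frame_in_hyperboloid[OF assms] by (rule emb_unemb)
qed (use assms in \<open>auto simp: hyperboloid_def\<close>)

lemma geodesic_line_through:
  assumes z: "z \<in> hyp_plane" and w: "w \<in> hyp_plane" and "z \<noteq> w"
  obtains \<alpha> d where "geodesic_line \<alpha>" "\<alpha> 0 = z" "\<alpha> d = w" "d > 0"
proof -
  define d where "d = hyp_dist z w"
  have d: "d > 0"
    using hyp_dist_nonneg[OF z w] hyp_dist_eq_0_iff[OF z w] \<open>z \<noteq> w\<close> by (simp add: d_def)
  have zw: "lorentz (emb z) (emb w) = cosh d"
    using cosh_hyp_dist[OF z w] by (simp add: d_def)
  note zz = lorentz_emb_self[OF z] and ww = lorentz_emb_self[OF w]
  \<comment> \<open>Gram-Schmidt: the part of \<open>emb w\<close> orthogonal to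
    \<open>emb z\<close> has norm \<open>1 - (cosh d)\<^sup>2\<close>, that is, minus the square of
    \<open>sinh d\<close>.\<close>
  define v where "v = (1 / sinh d) *\<^sub>R (emb w - cosh d *\<^sub>R emb z)"
  have v0: "lorentz (emb z) v = 0"
    by (simp add: v_def lorentz_linear zw zz)
  have "lorentz v v = (1 - (cosh d)\<^sup>2) / (sinh d)\<^sup>2"
    using d by (simp add: v_def lorentz_linear lorentz_commute[of "emb w" "emb z"] zw zz ww
        power2_eq_square field_simps)
  also have "\<dots> = -1"
    using d by (simp add: cosh_square_eq)
  finally have v1: "lorentz v v = -1" .
  have "unemb (cosh d *\<^sub>R emb z + sinh d *\<^sub>R v) = w"
    using d w by (simp add: v_def unemb_emb)
  then show ?thesis
    using that[OF geodesic_line_frame[OF emb_in_hyperboloid[OF z] v0 v1], of d] d z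
    by (simp add: unemb_emb)
qed

section \<open>Half-turns and axes\<close>

text \<open>The conjugate of the map sending z to -1/z, the half-turn about the imaginary unit, by
  the affine map that multiplies by \<open>Im q\<close> and adds \<open>Re q\<close>. The explicit
  formula makes holomorphy evident.\<close>

definition half_turn :: "complex \<Rightarrow> complex \<Rightarrow> complex" where
  "half_turn q z = of_real (Re q) - of_real ((Im q)\<^sup>2) / (z - of_real (Re q))"

lemma holomorphic_half_turn: "half_turn q holomorphic_on hyp_plane"
  unfolding half_turn_def
  by (intro holomorphic_intros) (auto simp: hyp_plane_def complex_eq_iff)

text \<open>On the hyperboloid the half-turn is linear: it fixes \<open>emb q\<close> and is -1 on
  the orthogonal complement.\<close>

lemma
  assumes q: "q \<in> hyp_plane" and z: "z \<in> hyp_plane"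
  shows half_turn_in_hyp_plane: "half_turn q z \<in> hyp_plane"
    and emb_half_turn:
      "emb (half_turn q z) = (2 * lorentz (emb q) (emb z)) *\<^sub>R emb q - emb z"
proof -
  obtain m n where qmn: "q = Complex m n" by (cases q)
  obtain a b where zab: "z = Complex a b" by (cases z)
  have pos: "n > 0" "b > 0" using q z by (auto simp: qmn zab hyp_plane_def)
  define D where "D = (a - m)\<^sup>2 + b\<^sup>2"
  have D: "D > 0" using pos by (simp add: D_def sum_power2_gt_zero_iff)
  define u where "u = (2 * lorentz (emb q) (emb z)) *\<^sub>R emb q - emb z"
  have B: "lorentz (emb q) (emb z) = (D + n\<^sup>2) / (2 * b * n)"
    using pos by (simp add: qmn zab emb_def lorentz_def D_def power2_eq_square field_simps)
  have uu: "lorentz u u = 1"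
    using lorentz_emb_self[OF q] lorentz_emb_self[OF z]
    by (simp add: u_def lorentz_linear lorentz_commute[of "emb z" "emb q"])
  \<comment> \<open>\<open>unemb\<close> reads only the last two coordinates; the first one is
    determined by the norm relation \<open>uu\<close>.\<close>
  have u3: "snd (snd u) = D / (b * n\<^sup>2)"
    unfolding u_def B using pos by (simp add: qmn zab emb_def power2_eq_square field_simps)
  have u2: "fst (snd u) = m * D / (b * n\<^sup>2) - (a - m) / b"
    unfolding u_def B using pos by (simp add: qmn zab emb_def power2_eq_square field_simps)
  have u: "u \<in> hyperboloid"
    using uu u3 pos D by (simp add: hyperboloid_def)
  have "half_turn q z = unemb u"
  proof (rule complex_eqI)
    show "Re (half_turn q z) = Re (unemb u)"
      using pos D unfolding unemb_def u2 u3
      by (simp add: half_turn_def qmn zab Re_divide D_def[symmetric])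
         (simp add: power2_eq_square field_simps)?
    show "Im (half_turn q z) = Im (unemb u)"
      using pos D unfolding unemb_def u2 u3
      by (simp add: half_turn_def qmn zab Im_divide D_def[symmetric])
         (simp add: power2_eq_square field_simps)?
  qed
  then show "half_turn q z \<in> hyp_plane"
    and "emb (half_turn q z) = (2 * lorentz (emb q) (emb z)) *\<^sub>R emb q - emb z"
    using u emb_unemb unemb_in_hyp_plane by (auto simp: u_def)
qed

lemma half_turn_geodesic_line:
  assumes \<alpha>: "geodesic_line \<alpha>"
  shows "half_turn (\<alpha> s) (\<alpha> t) = \<alpha> (2 * s - t)"
proof -
  obtain V where V: "lorentz (emb (\<alpha> 0)) V = 0" "lorentz V V = -1"
      "\<And>t. emb (\<alpha> t) = cosh t *\<^sub>R emb (\<alpha> 0) + sinh t *\<^sub>R V"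
    using geodesic_lineE[OF \<alpha>] by metis
  note H = geodesic_line_hyp_plane[OF \<alpha>]
  have L: "lorentz (emb (\<alpha> s)) (emb (\<alpha> t)) = cosh (s - t)"
    using geodesic_line_dist[OF \<alpha>] hyp_dist_eq_abs_iff[OF H H] by blast
  have c: "cosh (2 * s - t) = 2 * cosh (s - t) * cosh s - cosh t"
    using cosh_add[of "s - t" s] cosh_diff[of s "s - t"] by (simp add: algebra_simps)
  have d: "sinh (2 * s - t) = 2 * cosh (s - t) * sinh s - sinh t"
    using sinh_add[of "s - t" s] sinh_diff[of s "s - t"] by (simp add: algebra_simps)
  have "emb (half_turn (\<alpha> s) (\<alpha> t)) = (2 * cosh (s - t)) *\<^sub>R emb (\<alpha> s) - emb (\<alpha> t)"
    by (simp add: emb_half_turn H L)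
  also have "\<dots> = cosh (2 * s - t) *\<^sub>R emb (\<alpha> 0) + sinh (2 * s - t) *\<^sub>R V"
    unfolding V(3)[of s] V(3)[of t] c d by (simp add: algebra_simps)
  also have "\<dots> = emb (\<alpha> (2 * s - t))" by (rule V(3)[symmetric])
  finally show ?thesis
    using H half_turn_in_hyp_plane emb_inject by blast
qed

lemma half_turn_involution:
  assumes q: "q \<in> hyp_plane" and z: "z \<in> hyp_plane"
  shows "half_turn q (half_turn q z) = z"
proof -
  have "emb (half_turn q (half_turn q z)) = emb z"
    using q z lorentz_emb_self[OF q]
    by (simp add: emb_half_turn half_turn_in_hyp_plane lorentz_linear)
  then show ?thesis
    using q z half_turn_in_hyp_plane emb_inject by blast
qed

text \<open>A line has accumulation points in the plane, so the identity theorem applies. Holomorphy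
  is essential: the reflection in the line also fixes each of its points.\<close>

lemma holomorphic_eq_on_geodesic_line:
  assumes S: "S holomorphic_on hyp_plane" and T: "T holomorphic_on hyp_plane"
    and \<alpha>: "geodesic_line \<alpha>" and eq: "\<And>t. S (\<alpha> t) = T (\<alpha> t)" and z: "z \<in> hyp_plane"
  shows "S z = T z"
proof -
  note H = geodesic_line_hyp_plane[OF \<alpha>]
  have inj: "\<alpha> s \<noteq> \<alpha> t" if "s \<noteq> t" for s t
    using that geodesic_line_dist[OF \<alpha>, of s t] hyp_dist_self[OF H] by auto
  have lim: "\<alpha> 0 islimpt range \<alpha>"
    unfolding islimpt_sequential
  proof (intro exI conjI allI)
    have "isCont \<alpha> 0"
      using continuous_on_geodesic_line[OF \<alpha>, of UNIV] continuous_on_eq_continuous_at by blast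
    then show "(\<lambda>n. \<alpha> (1 / real (Suc n))) \<longlonglongrightarrow> \<alpha> 0"
      by (rule isCont_tendsto_compose) (rule LIMSEQ_Suc[OF lim_1_over_n])
    show "\<alpha> (1 / real (Suc n)) \<in> range \<alpha> - {\<alpha> 0}" for n
      using inj[of "1 / real (Suc n)" 0] by simp
  qed
  have "S z - T z = 0"
  proof (rule analytic_continuation[of "\<lambda>z. S z - T z" hyp_plane "range \<alpha>" "\<alpha> 0"])
    show "(\<lambda>z. S z - T z) holomorphic_on hyp_plane" by (intro holomorphic_intros S T)
    show "connected hyp_plane" using convex_hyp_plane by (rule convex_connected)
  qed (use open_hyp_plane H lim eq z in auto)
  then show ?thesis by simp
qed

text \<open>Half-turns about parameters \<open>s\<close> and \<open>s + l / 2\<close> send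
  \<open>t\<close> to \<open>2 * s - t\<close> and then to \<open>t + l\<close>. The free
  \<open>s\<close> allows \<open>P'\<close> to be the first centre for one translation and the
  second centre for the other.\<close>

lemma directed_axis_half_turns:
  assumes T: "T holomorphic_on hyp_plane" and ax: "directed_axis T l \<alpha>" and z: "z \<in> hyp_plane"
  shows "T z = half_turn (\<alpha> (s + l / 2)) (half_turn (\<alpha> s) z)"
proof -
  have \<alpha>: "geodesic_line \<alpha>" and l: "\<And>t. T (\<alpha> t) = \<alpha> (t + l)"
    using ax by (auto simp: directed_axis_def)
  note H = geodesic_line_hyp_plane[OF \<alpha>]
  have "T z = (half_turn (\<alpha> (s + l / 2)) \<circ> half_turn (\<alpha> s)) z"
  proof (rule holomorphic_eq_on_geodesic_line[OF T _ \<alpha> _ z])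
    show "half_turn (\<alpha> (s + l / 2)) \<circ> half_turn (\<alpha> s) holomorphic_on hyp_plane"
      by (intro holomorphic_on_compose_gen[OF holomorphic_half_turn holomorphic_half_turn])
         (use H half_turn_in_hyp_plane in blast)
    show "T (\<alpha> t) = (half_turn (\<alpha> (s + l / 2)) \<circ> half_turn (\<alpha> s)) (\<alpha> t)" for t
      by (simp add: half_turn_geodesic_line[OF \<alpha>] l) (simp add: algebra_simps)
  qed
  then show ?thesis by simp
qed

section \<open>Displacement and uniqueness of the axis\<close>

lemma lorentz_gram_nonneg:
  "lorentz p p * lorentz q q * lorentz z z + 2 * lorentz p q * lorentz p z * lorentz q z
    - lorentz p p * (lorentz q z)\<^sup>2 - lorentz q q * (lorentz p z)\<^sup>2 - lorentz z z * (lorentz p q)\<^sup>2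
   \<ge> 0" (is "?G \<ge> 0")
proof -
  \<comment> \<open>A Gram determinant is the squared determinant of the coordinates times the
    determinant of the form, which here is 1/4.\<close>
  have eq: "?G = (fst p * (fst (snd q) * snd (snd z) - snd (snd q) * fst (snd z))
    - fst (snd p) * (fst q * snd (snd z) - snd (snd q) * fst z)
    + snd (snd p) * (fst q * fst (snd z) - fst (snd q) * fst z))\<^sup>2 / 4"
    by (simp add: lorentz_def field_simps power2_eq_square)
  show ?thesis
    by (subst eq) simp
qed

text \<open>The displacement of a translation is minimal exactly on its axis: for the product of the
  half-turns about \<open>p\<close> and \<open>q\<close>, the hyperbolic cosine of the displacement of \<open>z\<close> is
  \<open>cosh l\<close> plus twice the Gram determinant of \<open>p\<close>, \<open>q\<close>, \<open>z\<close>.\<close>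

lemma
  assumes T: "T holomorphic_on hyp_plane" and ax: "directed_axis T l \<alpha>" and z: "z \<in> hyp_plane"
    and Tz: "hyp_dist z (T z) = l'" and l': "l' \<ge> 0"
  shows displacement_ge: "l' \<ge> l"
    and displacement_eq_imp_on_axis: "l' = l \<Longrightarrow> z \<in> range \<alpha>"
proof -
  have \<alpha>: "geodesic_line \<alpha>" and l: "l > 0"
    using ax by (auto simp: directed_axis_def)
  note H = geodesic_line_hyp_plane[OF \<alpha>]
  define p q where "p = emb (\<alpha> (l / 2))" and "q = emb (\<alpha> 0)"
  define G where "G = 1 + 2 * lorentz p q * lorentz p (emb z) * lorentz q (emb z)
    - (lorentz q (emb z))\<^sup>2 - (lorentz p (emb z))\<^sup>2 - (lorentz p q)\<^sup>2"
  have pp: "lorentz p p = 1" "lorentz q q = 1" and zz: "lorentz (emb z) (emb z) = 1"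
    using H z lorentz_emb_self by (auto simp: p_def q_def)
  have pq: "lorentz p q = cosh (l / 2)"
    using hyp_dist_eq_abs_iff[OF H H, of "l/2" 0 "l/2"] geodesic_line_dist[OF \<alpha>, of "l/2" 0]
    by (simp add: p_def q_def)
  have G0: "G \<ge> 0"
    using lorentz_gram_nonneg[of p q "emb z"] by (simp add: G_def pp zz)
  have "T z = half_turn (\<alpha> (l / 2)) (half_turn (\<alpha> 0) z)"
    using directed_axis_half_turns[OF T ax z, of 0] by simp
  then have TzH: "T z \<in> hyp_plane" and
    eT: "emb (T z) = (2 * lorentz p ((2 * lorentz q (emb z)) *\<^sub>R q - emb z)) *\<^sub>R p
        - ((2 * lorentz q (emb z)) *\<^sub>R q - emb z)"
    using H z by (simp_all add: half_turn_in_hyp_plane emb_half_turn p_def q_def)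
  have "lorentz (emb z) (emb (T z)) = 2 * G + (2 * (lorentz p q)\<^sup>2 - 1)"
    unfolding eT
    by (simp add: lorentz_linear lorentz_commute[of "emb z" p] lorentz_commute[of "emb z" q] zz G_def power2_eq_square algebra_simps)
  also have "2 * (lorentz p q)\<^sup>2 - 1 = cosh l"
    using cosh_double_cosh[of "l / 2"] by (simp add: pq)
  finally have c: "cosh l' = 2 * G + cosh l"
    using cosh_hyp_dist[OF z TzH] Tz by simp
  then have "cosh l \<le> cosh l'" using G0 by simp
  then show "l' \<ge> l"
    using l l' cosh_real_nonneg_le_iff[of l l'] by simp
  assume "l' = l"
  with c have G: "G = 0" by simp
  obtain V where V: "lorentz q V = 0" "lorentz V V = -1"
      "\<And>t. emb (\<alpha> t) = cosh t *\<^sub>R q + sinh t *\<^sub>R V"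
    using geodesic_lineE[OF \<alpha>] unfolding q_def by metis
  \<comment> \<open>\<open>m\<close> and \<open>k\<close> are the coordinates of
    \<open>emb z\<close> in the plane spanned by \<open>q\<close> and \<open>V\<close>, with a minus
    sign because \<open>V\<close> has norm -1; \<open>d\<close> is the remaining component.
    Vanishing of \<open>G\<close> gives \<open>mk\<close>, which makes \<open>d\<close>
    null.\<close>
  define k where "k = - lorentz V (emb z)"
  define m where "m = lorentz q (emb z)"
  define d where "d = emb z - m *\<^sub>R q - k *\<^sub>R V"
  have pV: "p = cosh (l / 2) *\<^sub>R q + sinh (l / 2) *\<^sub>R V" by (simp only: V(3) p_def)
  have "lorentz p (emb z) = cosh (l / 2) * m - sinh (l / 2) * k"
    by (simp add: pV lorentz_linear m_def k_def)
  then have "0 = 1 + 2 * cosh (l/2) * (cosh (l / 2) * m - sinh (l / 2) * k) * m - m\<^sup>2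
     - (cosh (l / 2) * m - sinh (l / 2) * k)\<^sup>2 - (cosh (l / 2))\<^sup>2"
    using G by (simp add: G_def pq m_def)
  also have "\<dots> = (1 - (cosh (l / 2))\<^sup>2) + m\<^sup>2 * ((cosh (l / 2))\<^sup>2 - 1) - (sinh (l / 2))\<^sup>2 * k\<^sup>2"
    by (simp add: power2_eq_square algebra_simps)
  also have "\<dots> = (sinh (l / 2))\<^sup>2 * (m\<^sup>2 - k\<^sup>2 - 1)"
    by (simp add: cosh_square_eq algebra_simps)
  finally have mk: "m\<^sup>2 = 1 + k\<^sup>2" using l by simp
  have qd: "lorentz q d = 0" by (simp add: d_def lorentz_linear V(1) pp m_def)
  have Vd: "lorentz V d = 0" by (simp add: d_def lorentz_linear V lorentz_commute[of V q] k_def)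
  have "lorentz d d = lorentz (emb z) d"
    by (subst (1) d_def) (simp add: lorentz_linear qd Vd)
  also have "\<dots> = 1 - m\<^sup>2 + k\<^sup>2"
    by (simp add: d_def lorentz_linear zz lorentz_commute[of "emb z" q] lorentz_commute[of "emb z" V] m_def[symmetric] k_def
        power2_eq_square)
  also have "\<dots> = 0" using mk by simp
  finally have "d = 0"
    using lorentz_orthogonal_null[OF _ qd] emb_in_hyperboloid[OF H] unfolding q_def by blast
  then have "emb z = m *\<^sub>R q + k *\<^sub>R V" by (simp add: d_def algebra_simps)
  \<comment> \<open>This selects the positive root of \<open>mk\<close>, so that
    \<open>arsinh k\<close> is the parameter of \<open>z\<close> on the axis.\<close>
  moreover have "m \<ge> 1" unfolding m_def q_def by (rule lorentz_emb_ge_1[OF H z])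
  then have "m = cosh (arsinh k)"
    by (simp add: cosh_arsinh_real mk[symmetric] add.commute)
  ultimately have "emb z = emb (\<alpha> (arsinh k))"
    by (simp add: V(3))
  then show "z \<in> range \<alpha>"
    using emb_inject[OF z H] by blast
qed

text \<open>Minimality of the displacement, used in both directions, gives equal lengths. Then
  \<open>\<beta> 0\<close> lies on \<open>\<alpha>\<close>, and applying \<open>T\<close> yields a
  second common point.\<close>

lemma directed_axis_unique:
  assumes T: "T holomorphic_on hyp_plane"
    and \<alpha>: "directed_axis T l \<alpha>" and \<beta>: "directed_axis T l' \<beta>"
  shows "l' = l" and "\<exists>s. \<forall>t. \<beta> t = \<alpha> (t + s)"
proof -
  have g: "geodesic_line \<alpha>" "geodesic_line \<beta>" and l: "l > 0" "l' > 0"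
    and Ta: "\<And>t. T (\<alpha> t) = \<alpha> (t + l)" and Tb: "\<And>t. T (\<beta> t) = \<beta> (t + l')"
    using \<alpha> \<beta> by (auto simp: directed_axis_def)
  note Ha = geodesic_line_hyp_plane[OF g(1)] and Hb = geodesic_line_hyp_plane[OF g(2)]
  have da: "hyp_dist (\<alpha> t) (T (\<alpha> t)) = l" and db: "hyp_dist (\<beta> t) (T (\<beta> t)) = l'" for t
    using l g by (simp_all add: Ta Tb geodesic_line_dist)
  show eq: "l' = l"
    using displacement_ge[OF T \<alpha> Hb db] displacement_ge[OF T \<beta> Ha da] l by force
  obtain s where s: "\<beta> 0 = \<alpha> s"
    using displacement_eq_imp_on_axis[OF T \<alpha> Hb db _ eq, of 0] l by auto
  have "\<beta> l = \<alpha> (l + s)"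
    using Ta[of s] Tb[of 0] by (simp add: s eq add.commute)
  then have "\<beta> = (\<lambda>t. \<alpha> (t + s))"
    using geodesic_line_unique[OF g(2) geodesic_line_shift[OF g(1)], of 0 s l] s l by simp
  then show "\<exists>s. \<forall>t. \<beta> t = \<alpha> (t + s)" by auto
qed

text \<open>The translation length is twice the distance of the centres. The parameters of the
  centres are recorded because these points project to the midpoints.\<close>

lemma half_turns_directed_axis:
  assumes q: "q \<in> hyp_plane" and r: "r \<in> hyp_plane" "q \<noteq> r"
    and T: "\<And>z. z \<in> hyp_plane \<Longrightarrow> T z = half_turn r (half_turn q z)"
  obtains l \<alpha> where "directed_axis T l \<alpha>" "\<alpha> 0 = q" "\<alpha> (l / 2) = r"
proof -
  obtain \<alpha> d where \<alpha>: "geodesic_line \<alpha>" "\<alpha> 0 = q" "\<alpha> d = r" "d > 0"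
    using geodesic_line_through[OF q r] by metis
  have "T (\<alpha> t) = \<alpha> (t + 2 * d)" for t
  proof -
    have "T (\<alpha> t) = half_turn (\<alpha> d) (half_turn (\<alpha> 0) (\<alpha> t))"
      using T[OF geodesic_line_hyp_plane[OF \<alpha>(1)]] \<alpha> by simp
    then show ?thesis
      by (simp add: half_turn_geodesic_line[OF \<alpha>(1)] add.commute)
  qed
  then have "directed_axis T (2 * d) \<alpha>"
    using \<alpha> by (auto simp: directed_axis_def)
  then show ?thesis using that \<alpha> by simp
qed

text \<open>With \<open>P\<close> the common point of the axes of \<open>X\<close> and \<open>Y\<close>, write \<open>X\<close> and \<open>Y\<close> as products of
  two half-turns, one of them about \<open>P\<close>; these two cancel in \<open>X \<circ> Y\<close>.\<close>

lemma directed_axis_compose: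
  assumes X: "X holomorphic_on hyp_plane" "directed_axis X a \<xi>"
    and Y: "Y holomorphic_on hyp_plane" "directed_axis Y b \<eta>"
    and P: "\<xi> 0 = \<eta> 0" and ne: "\<xi> (a / 2) \<noteq> \<eta> (- (b / 2))"
  obtains l \<alpha> where "directed_axis (X \<circ> Y) l \<alpha>" "\<alpha> 0 = \<eta> (- (b / 2))" "\<alpha> (l / 2) = \<xi> (a / 2)"
proof (rule half_turns_directed_axis)
  have g: "geodesic_line \<xi>" "geodesic_line \<eta>"
    using X Y by (auto simp: directed_axis_def)
  note H = geodesic_line_hyp_plane[OF g(1)] geodesic_line_hyp_plane[OF g(2)]
  show "\<eta> (- (b / 2)) \<in> hyp_plane" "\<xi> (a / 2) \<in> hyp_plane" by (rule H)+
  show "\<eta> (- (b / 2)) \<noteq> \<xi> (a / 2)" using ne by simp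
  fix z assume z: "z \<in> hyp_plane"
  let ?w = "half_turn (\<eta> (- (b / 2))) z"
  have w: "?w \<in> hyp_plane" using H z half_turn_in_hyp_plane by blast
  \<comment> \<open>Starting half a translation behind the common point makes
    \<open>\<eta> 0\<close> the second centre, ready to cancel against \<open>X\<close>.\<close>
  have Yz: "Y z = half_turn (\<eta> 0) ?w"
    using directed_axis_half_turns[OF Y z, of "- (b / 2)"] by simp
  then have "Y z \<in> hyp_plane" using half_turn_in_hyp_plane[OF H(2) w] by simp
  then have "X (Y z) = half_turn (\<xi> (a / 2)) (half_turn (\<eta> 0) (Y z))"
    using directed_axis_half_turns[OF X, of "Y z" 0] P by simp
  also have "half_turn (\<eta> 0) (Y z) = ?w"
    unfolding Yz by (rule half_turn_involution[OF H(2) w])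
  finally show "(X \<circ> Y) z = half_turn (\<xi> (a / 2)) ?w" by simp
qed (use that in blast)

section \<open>Lifting to covering spaces of metric spaces\<close>

text \<open>The Kuratowski embedding into the bounded continuous functions. The distance to an
  arbitrary base point, here \<open>undefined\<close>, is subtracted to make the function
  bounded.\<close>

definition kuratowski :: "'a::metric_space \<Rightarrow> ('a \<Rightarrow>\<^sub>C real)" where
  "kuratowski a = Bcontfun (\<lambda>x. dist a x - dist undefined x)"

lemma apply_kuratowski: "apply_bcontfun (kuratowski a) x = dist a x - dist undefined x"
proof -
  have "(\<lambda>x. dist a x - dist undefined x) \<in> bcontfun"
  proof (rule bcontfun_normI)
    show "norm (dist a x - dist undefined x) \<le> dist a undefined" for x
      using abs_dist_diff_le[of a x undefined] by (simp add: dist_commute)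
  qed (intro continuous_intros)
  then show ?thesis by (simp add: kuratowski_def Bcontfun_inverse)
qed

lemma dist_kuratowski: "dist (kuratowski a) (kuratowski b) = dist a b"
proof (rule antisym)
  show "dist (kuratowski a) (kuratowski b) \<le> dist a b"
    by (rule dist_bound)
       (use abs_dist_diff_le[of a _ b] in \<open>simp add: apply_kuratowski dist_real_def dist_commute\<close>)
  show "dist a b \<le> dist (kuratowski a) (kuratowski b)"
    using dist_bounded[of "kuratowski a" b "kuratowski b"]
    by (simp add: apply_kuratowski dist_real_def)
qed

lemma inv_kuratowski: "inv_into UNIV kuratowski (kuratowski a) = a"
proof (intro inv_f_f injI)
  fix b c :: 'a
  assume "kuratowski b = kuratowski c"
  then show "b = c" using dist_kuratowski[of b c] by simp
qed

lemma homeomorphism_kuratowski: "homeomorphism T (kuratowski ` T) kuratowski (inv_into UNIV kuratowski)"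
proof
  show "continuous_on T kuratowski" "continuous_on (kuratowski ` T) (inv_into UNIV kuratowski)"
    by (auto simp: continuous_on_iff dist_kuratowski inv_kuratowski)
qed (auto simp: inv_kuratowski)

text \<open>\<open>K\<close> is required to be a homeomorphism on every subset of \<open>S\<close>
  because the sheets map onto evenly covered sets, and these are transported as well.\<close>

lemma covering_space_homeomorphic_base:
  assumes cov: "covering_space C p S" and K: "\<And>T. T \<subseteq> S \<Longrightarrow> homeomorphism T (K ` T) K J"
  shows "covering_space C (K \<circ> p) (K ` S)"
proof
  note pS = covering_space_imp_surjective[OF cov]
  have JK: "J (K a) = a" if "a \<in> S" for a
    using K[OF order_refl] that by (auto simp: homeomorphism_def)
  show "continuous_on C (K \<circ> p)"
    using covering_space_imp_continuous[OF cov] homeomorphism_cont1[OF K[OF order_refl]] pS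
    by (intro continuous_on_compose) simp_all
  show "(K \<circ> p) ` C = K ` S" using pS by auto
  fix b assume "b \<in> K ` S"
  then obtain a where a: "a \<in> S" "b = K a" by blast
  then obtain T v where T: "a \<in> T" "openin (top_of_set S) T" and v: "\<Union>v = C \<inter> p -` T"
      "\<forall>u\<in>v. openin (top_of_set C) u" "pairwise disjnt v" "\<forall>u\<in>v. \<exists>q. homeomorphism u T p q"
    using cov unfolding covering_space_def by metis
  have TS: "T \<subseteq> S" using T openin_imp_subset by blast
  show "\<exists>T. b \<in> T \<and> openin (top_of_set (K ` S)) T \<and>
      (\<exists>v. \<Union>v = C \<inter> (K \<circ> p) -` T \<and> (\<forall>u\<in>v. openin (top_of_set C) u) \<and>
        pairwise disjnt v \<and> (\<forall>u\<in>v. \<exists>q. homeomorphism u T (K \<circ> p) q))"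
  proof (intro exI conjI)
    show "b \<in> K ` T" using a T by blast
    show "openin (top_of_set (K ` S)) (K ` T)"
      using homeomorphism_imp_open_map[OF K[OF order_refl] T(2)] .
    have "p w \<in> T" if "w \<in> C" "K (p w) \<in> K ` T" for w
      using that JK TS pS by (metis imageE imageI subsetD)
    then show "\<Union>v = C \<inter> (K \<circ> p) -` (K ` T)" using v(1) by auto
    show "\<forall>u\<in>v. \<exists>q. homeomorphism u (K ` T) (K \<circ> p) q"
      using v(4) homeomorphism_compose K[OF TS] by blast
  qed (use v in auto)
qed

text \<open>The lifting theorems of the library are stated for a base space inside a normed space, hence
  the detour through the isometric embedding.\<close>

lemma covering_space_lift_strong_metric:
  fixes p :: "'a::real_normed_vector \<Rightarrow> 'b::metric_space"
    and f :: "'c::real_normed_vector \<Rightarrow> 'b"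
  assumes cov: "covering_space C p S" "a \<in> C" "z \<in> U"
    and U: "simply_connected U" "locally path_connected U"
    and f: "continuous_on U f" "f \<in> U \<rightarrow> S" "f z = p a"
  obtains g where "continuous_on U g" "g \<in> U \<rightarrow> C" "g z = a" "\<And>y. y \<in> U \<Longrightarrow> p (g y) = f y"
proof -
  note J = inv_kuratowski and K = homeomorphism_kuratowski
  have "continuous_on U (kuratowski \<circ> f)"
    using homeomorphism_cont1[OF K] by (rule continuous_on_compose[OF f(1)])
  then obtain g where g: "continuous_on U g" "g \<in> U \<rightarrow> C" "g z = a"
      "\<And>y. y \<in> U \<Longrightarrow> (kuratowski \<circ> p) (g y) = (kuratowski \<circ> f) y"
  proof (rule covering_space_lift_strong[OF covering_space_homeomorphic_base[OF cov(1) K] cov(2,3) U])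
    show "kuratowski \<circ> f \<in> U \<rightarrow> kuratowski ` S" using f(2) by auto
    show "(kuratowski \<circ> f) z = (kuratowski \<circ> p) a" using f(3) by simp
  qed (rule that)
  have "p (g y) = f y" if "y \<in> U" for y
    using arg_cong[OF g(4)[OF that], of "inv_into UNIV kuratowski"] by (simp add: J)
  with g(1-3) show ?thesis by (rule that)
qed

lemma covering_space_lift_homotopy_metric:
  fixes p :: "'a::real_normed_vector \<Rightarrow> 'b::metric_space"
    and h :: "real \<times> 'c::real_normed_vector \<Rightarrow> 'b"
  assumes cov: "covering_space C p S"
    and h: "continuous_on ({0..1} \<times> U) h" "h \<in> ({0..1} \<times> U) \<rightarrow> S"
    and heq: "\<And>y. y \<in> U \<Longrightarrow> h (0, y) = p (f y)"
    and f: "continuous_on U f" "f \<in> U \<rightarrow> C"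
  obtains k where "continuous_on ({0..1} \<times> U) k" "k \<in> ({0..1} \<times> U) \<rightarrow> C"
    "\<And>y. y \<in> U \<Longrightarrow> k (0, y) = f y" "\<And>z. z \<in> {0..1} \<times> U \<Longrightarrow> p (k z) = h z"
proof -
  note J = inv_kuratowski and K = homeomorphism_kuratowski
  have Kh: "continuous_on ({0..1} \<times> U) (kuratowski \<circ> h)"
    using homeomorphism_cont1[OF K] by (rule continuous_on_compose[OF h(1)])
  obtain k where k: "continuous_on ({0..1} \<times> U) k" "k \<in> ({0..1} \<times> U) \<rightarrow> C"
      "\<And>y. y \<in> U \<Longrightarrow> k (0, y) = f y" "\<And>z. z \<in> {0..1} \<times> U \<Longrightarrow> (kuratowski \<circ> h) z = (kuratowski \<circ> p) (k z)"
  proof (rule covering_space_lift_homotopy[OF covering_space_homeomorphic_base[OF cov K] Kh _ _ f])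
    show "kuratowski \<circ> h \<in> {0..1} \<times> U \<rightarrow> kuratowski ` S" using h(2) by auto
    show "(kuratowski \<circ> h) (0, y) = (kuratowski \<circ> p) (f y)" if "y \<in> U" for y using heq that by simp
  qed (rule that)
  have "p (k z) = h z" if "z \<in> {0..1} \<times> U" for z
    using arg_cong[OF k(4)[OF that], of "inv_into UNIV kuratowski"] by (simp add: J)
  with k(1-3) show ?thesis by (rule that)
qed

lemma homotopic_loops_conjugate_metric:
  fixes S :: "'a::metric_space set"
  assumes "path c" "path q" "path_image c \<subseteq> S" "path_image q \<subseteq> S"
    and "pathfinish c = pathstart q" "pathfinish q = pathstart q"
  shows "homotopic_loops S (c +++ q +++ reversepath c) q"
proof -
  note J = inv_kuratowski and K = homeomorphism_kuratowski
  have cont: "continuous_on T kuratowski" for T by (rule homeomorphism_cont1[OF K])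
  have "homotopic_loops (kuratowski ` S) ((kuratowski \<circ> c) +++ (kuratowski \<circ> q) +++ reversepath (kuratowski \<circ> c)) (kuratowski \<circ> q)"
  proof (rule homotopic_loops_conjugate)
    show "path (kuratowski \<circ> c)" "path (kuratowski \<circ> q)"
      by (intro path_continuous_image assms cont)+
    show "path_image (kuratowski \<circ> c) \<subseteq> kuratowski ` S" "path_image (kuratowski \<circ> q) \<subseteq> kuratowski ` S"
      using assms by (auto simp: path_image_def)
  qed (use assms in \<open>auto simp: pathstart_compose pathfinish_compose\<close>)
  then have "homotopic_loops (kuratowski ` S) (kuratowski \<circ> (c +++ q +++ reversepath c)) (kuratowski \<circ> q)"
    by (simp add: path_compose_join path_compose_reversepath)
  then have "homotopic_loops S (inv_into UNIV kuratowski \<circ> (kuratowski \<circ> (c +++ q +++ reversepath c))) (inv_into UNIV kuratowski \<circ> (kuratowski \<circ> q))"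
    by (rule homotopic_loops_continuous_image[OF _ homeomorphism_cont2[OF K]]) (simp add: Pi_iff J)
  moreover have "inv_into UNIV kuratowski \<circ> (kuratowski \<circ> f) = f" for f :: "real \<Rightarrow> 'a" by (auto simp: J)
  ultimately show ?thesis by simp
qed

section \<open>Closed geodesics and deck transformations\<close>

lemma universal_cover_covering_space: "universal_cover S A p \<Longrightarrow> covering_space hyp_plane p S"
  by (simp add: universal_cover_def)

lemma universal_cover_in_base: "universal_cover S A p \<Longrightarrow> w \<in> hyp_plane \<Longrightarrow> p w \<in> S"
  using covering_space_imp_surjective universal_cover_covering_space by blast

text \<open>The metric ball is replaced by an open set of complex numbers, to which continuity and
  holomorphy arguments apply.\<close>

lemma universal_cover_local_isometry:
  assumes "universal_cover S A p" "w \<in> hyp_plane"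
  obtains N where "open N" "w \<in> N" "N \<subseteq> hyp_plane"
    "\<And>u v. u \<in> N \<Longrightarrow> v \<in> N \<Longrightarrow> dist (p u) (p v) = hyp_dist u v"
proof -
  obtain r where r: "r > 0" "\<forall>u\<in>hyp_plane. \<forall>v\<in>hyp_plane.
      hyp_dist w u < r \<and> hyp_dist w v < r \<longrightarrow> dist (p u) (p v) = hyp_dist u v"
    using assms unfolding universal_cover_def by blast
  obtain N where "open N" "w \<in> N" "\<forall>u\<in>N. u \<in> hyp_plane \<and> hyp_dist w u < r"
    using eventually_hyp_dist_less[OF assms(2) r(1)] unfolding eventually_nhds by blast
  then show ?thesis using r(2) by (intro that[of N]) blast+
qed

lemma universal_cover_local_isometry_path:
  fixes \<alpha> :: "real \<Rightarrow> complex"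
  assumes p: "universal_cover S A p" and \<alpha>: "continuous_on UNIV \<alpha>" "range \<alpha> \<subseteq> hyp_plane"
  obtains e where "e > 0" "\<And>s s'. s \<in> {t-e<..<t+e} \<Longrightarrow> s' \<in> {t-e<..<t+e} \<Longrightarrow>
    dist (p (\<alpha> s)) (p (\<alpha> s')) = hyp_dist (\<alpha> s) (\<alpha> s')"
proof -
  have "\<alpha> t \<in> hyp_plane" using \<alpha>(2) by blast
  from universal_cover_local_isometry[OF p this]
  obtain N where N: "open N" "\<alpha> t \<in> N"
    "\<And>u v. u \<in> N \<Longrightarrow> v \<in> N \<Longrightarrow> dist (p u) (p v) = hyp_dist u v"
    by metis
  have "open (\<alpha> -` N)" using \<alpha>(1) N(1) by (simp add: continuous_on_open_vimage open_vimage)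
  then obtain e where "e > 0" "ball t e \<subseteq> \<alpha> -` N"
    using N(2) by (metis openE vimageI)
  then show ?thesis
    by (intro that[of e] N(3)) (auto simp: ball_eq_greaterThanLessThan)
qed

lemma lift_of_closed_geodesic:
  assumes p: "universal_cover S A p" and z: "closed_geodesic S l z"
    and \<alpha>: "continuous_on UNIV \<alpha>" "range \<alpha> \<subseteq> hyp_plane" and eq: "\<And>t. p (\<alpha> t) = z t"
  shows "geodesic_line \<alpha>"
proof (rule locally_geodesic_imp_geodesic_line[OF \<alpha>(2)])
  fix t
  obtain e where e: "e > 0" "\<And>s s'. s \<in> {t-e<..<t+e} \<Longrightarrow> s' \<in> {t-e<..<t+e} \<Longrightarrow>
      dist (p (\<alpha> s)) (p (\<alpha> s')) = hyp_dist (\<alpha> s) (\<alpha> s')"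
    by (rule universal_cover_local_isometry_path[OF p \<alpha>, where t = t]) (rule that)
  obtain d where d: "d > 0" "\<forall>s\<in>{t-d<..<t+d}. \<forall>s'\<in>{t-d<..<t+d}. dist (z s) (z s') = \<bar>s - s'\<bar>"
    using z unfolding closed_geodesic_def by blast
  show "\<exists>e>0. \<forall>s\<in>{t-e<..<t+e}. \<forall>s'\<in>{t-e<..<t+e}. hyp_dist (\<alpha> s) (\<alpha> s') = \<bar>s - s'\<bar>"
  proof (intro exI[of _ "min d e"] conjI ballI)
    fix s s' assume "s \<in> {t - min d e<..<t + min d e}" "s' \<in> {t - min d e<..<t + min d e}"
    then have s: "s \<in> {t-d<..<t+d}" "s' \<in> {t-d<..<t+d}" "s \<in> {t-e<..<t+e}" "s' \<in> {t-e<..<t+e}"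
      by auto
    have "hyp_dist (\<alpha> s) (\<alpha> s') = dist (z s) (z s')" using e(2)[OF s(3,4)] by (simp add: eq)
    also have "\<dots> = \<bar>s - s'\<bar>" using d(2) s(1,2) by blast
    finally show "hyp_dist (\<alpha> s) (\<alpha> s') = \<bar>s - s'\<bar>" .
  qed (use d e in simp)
qed

lemma continuous_on_closed_geodesic:
  assumes "closed_geodesic S l z"
  shows "continuous_on T z"
proof (rule continuous_at_imp_continuous_on, rule ballI)
  fix t
  obtain d where d: "d > 0" "\<forall>s\<in>{t-d<..<t+d}. \<forall>s'\<in>{t-d<..<t+d}. dist (z s) (z s') = \<bar>s - s'\<bar>"
    using assms unfolding closed_geodesic_def by blast
  have "dist (z s) (z t) = \<bar>s - t\<bar>" if "\<bar>s - t\<bar> < d" for s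
  proof -
    have "s \<in> {t-d<..<t+d}" "t \<in> {t-d<..<t+d}" using that d(1) by (auto simp: abs_less_iff)
    then show ?thesis using d(2) by blast
  qed
  then show "isCont z t"
    unfolding continuous_at_eps_delta dist_real_def
    using d(1) by (metis min_less_iff_conj)
qed

lemma closed_geodesic_lift:
  assumes p: "universal_cover S A p" and z: "closed_geodesic S l z"
    and w: "w \<in> hyp_plane" "p w = z 0"
  obtains \<alpha> where "geodesic_line \<alpha>" "\<alpha> 0 = w" "\<And>t. p (\<alpha> t) = z t"
proof -
  have "range z \<subseteq> S" using z by (simp add: closed_geodesic_def)
  then obtain \<alpha> where \<alpha>: "continuous_on UNIV \<alpha>" "\<alpha> \<in> UNIV \<rightarrow> hyp_plane" "\<alpha> 0 = w"
      "\<And>t. t \<in> UNIV \<Longrightarrow> p (\<alpha> t) = z t"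
    using covering_space_lift_strong_metric[OF universal_cover_covering_space[OF p] w(1) UNIV_I[of "0::real"]
      convex_imp_simply_connected[OF convex_UNIV] convex_imp_locally_path_connected[OF convex_UNIV]
      continuous_on_closed_geodesic[OF z]] w(2)
    by (metis Pi_I UNIV_I rangeI subsetD)
  then show ?thesis
    using that lift_of_closed_geodesic[OF p z \<alpha>(1)] by (metis UNIV_I funcset_image)
qed

section \<open>Deck transformations are holomorphic isometries\<close>

lemma deck_transformationD:
  assumes "deck_transformation p T"
  shows "continuous_on hyp_plane T" "T ` hyp_plane = hyp_plane" "inj_on T hyp_plane"
    "w \<in> hyp_plane \<Longrightarrow> T w \<in> hyp_plane" "w \<in> hyp_plane \<Longrightarrow> p (T w) = p w"
  using assms unfolding deck_transformation_def homeomorphism_def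
  by (auto intro: inj_on_inverseI)

lemma deck_transformation_compose:
  assumes X: "deck_transformation p X" and Y: "deck_transformation p Y"
  shows "deck_transformation p (X \<circ> Y)"
proof -
  obtain X' Y' where "homeomorphism hyp_plane hyp_plane X X'" "homeomorphism hyp_plane hyp_plane Y Y'"
    using assms by (auto simp: deck_transformation_def)
  then have "homeomorphism hyp_plane hyp_plane (X \<circ> Y) (Y' \<circ> X')"
    by (rule homeomorphism_compose[rotated])
  moreover have "p ((X \<circ> Y) w) = p w" if "w \<in> hyp_plane" for w
    using that deck_transformationD[OF X] deck_transformationD[OF Y] by simp
  ultimately show ?thesis
    by (auto simp: deck_transformation_def)
qed

text \<open>Since \<open>p \<circ> T\<close> and \<open>p\<close> agree and \<open>p\<close> is a
  local isometry at both \<open>\<alpha> t\<close> and its image, \<open>T\<close> preserves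
  distances along short pieces of the line, which suffices for a global geodesic.\<close>

lemma deck_transformation_geodesic_line:
  assumes p: "universal_cover S A p" and T: "deck_transformation p T" and \<alpha>: "geodesic_line \<alpha>"
  shows "geodesic_line (\<lambda>t. T (\<alpha> t))"
proof (rule locally_geodesic_imp_geodesic_line)
  note H = geodesic_line_hyp_plane[OF \<alpha>]
  have cont: "continuous_on UNIV (\<lambda>t. T (\<alpha> t))"
    by (rule continuous_on_compose2[OF deck_transformationD(1)[OF T] continuous_on_geodesic_line[OF \<alpha>]])
       (use H in blast)
  have \<alpha>H: "range \<alpha> \<subseteq> hyp_plane" using H by blast
  show TH: "range (\<lambda>t. T (\<alpha> t)) \<subseteq> hyp_plane" using H deck_transformationD(4)[OF T] by blast
  fix t
  obtain e where e: "e > 0" "\<And>s s'. s \<in> {t-e<..<t+e} \<Longrightarrow> s' \<in> {t-e<..<t+e} \<Longrightarrow>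
      dist (p (\<alpha> s)) (p (\<alpha> s')) = hyp_dist (\<alpha> s) (\<alpha> s')"
    by (rule universal_cover_local_isometry_path[OF p continuous_on_geodesic_line[OF \<alpha>] \<alpha>H, where t = t]) (rule that)
  obtain d where d: "d > 0" "\<And>s s'. s \<in> {t-d<..<t+d} \<Longrightarrow> s' \<in> {t-d<..<t+d} \<Longrightarrow>
      dist (p (T (\<alpha> s))) (p (T (\<alpha> s'))) = hyp_dist (T (\<alpha> s)) (T (\<alpha> s'))"
    by (rule universal_cover_local_isometry_path[OF p cont TH, where t = t]) (rule that)
  show "\<exists>e>0. \<forall>s\<in>{t-e<..<t+e}. \<forall>s'\<in>{t-e<..<t+e}. hyp_dist (T (\<alpha> s)) (T (\<alpha> s')) = \<bar>s - s'\<bar>"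
  proof (intro exI[of _ "min d e"] conjI ballI)
    fix s s' assume "s \<in> {t - min d e<..<t + min d e}" "s' \<in> {t - min d e<..<t + min d e}"
    then have s: "s \<in> {t-d<..<t+d}" "s' \<in> {t-d<..<t+d}" "s \<in> {t-e<..<t+e}" "s' \<in> {t-e<..<t+e}"
      by auto
    show "hyp_dist (T (\<alpha> s)) (T (\<alpha> s')) = \<bar>s - s'\<bar>"
      using d(2)[OF s(1,2)] e(2)[OF s(3,4)] H
      by (simp add: deck_transformationD(5)[OF T] geodesic_line_dist[OF \<alpha>])
  qed (use d e in simp)
qed

text \<open>Two distinct points lie on a line, and its image is a line with the same
  parameter.\<close>

lemma deck_transformation_isometry:
  assumes p: "universal_cover S A p" and T: "deck_transformation p T"
    and z: "z \<in> hyp_plane" and w: "w \<in> hyp_plane"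
  shows "hyp_dist (T z) (T w) = hyp_dist z w"
proof (cases "z = w")
  case True
  then show ?thesis using z deck_transformationD(4)[OF T] by (simp add: hyp_dist_self)
next
  case False
  then obtain \<alpha> d where \<alpha>: "geodesic_line \<alpha>" "\<alpha> 0 = z" "\<alpha> d = w"
    using geodesic_line_through[OF z w] by metis
  then show ?thesis
    using geodesic_line_dist[OF deck_transformation_geodesic_line[OF p T \<alpha>(1)], of 0 d]
      geodesic_line_dist[OF \<alpha>(1), of 0 d] by simp
qed

lemma oriented_hyperbolic_surface_chart:
  assumes S: "oriented_hyperbolic_surface S A" and a: "a \<in> S"
  obtains U \<phi> where "(U, \<phi>) \<in> A" "a \<in> U" "openin (top_of_set S) U" "\<phi> ` U \<subseteq> hyp_plane"
    "\<forall>a\<in>U. \<forall>b\<in>U. hyp_dist (\<phi> a) (\<phi> b) = dist a b"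
proof -
  have "\<forall>a\<in>S. \<exists>(U, \<phi>)\<in>A. a \<in> U"
    using S unfolding oriented_hyperbolic_surface_def by (elim conjE)
  from bspec[OF this a] obtain U \<phi> where U: "(U, \<phi>) \<in> A" "a \<in> U" by blast
  have charts: "\<forall>(U, \<phi>)\<in>A. openin (top_of_set S) U \<and> open (\<phi> ` U) \<and> \<phi> ` U \<subseteq> hyp_plane \<and>
        (\<forall>a\<in>U. \<forall>b\<in>U. hyp_dist (\<phi> a) (\<phi> b) = dist a b)"
    using S unfolding oriented_hyperbolic_surface_def by (elim conjE)
  from bspec[OF charts U(1)] show ?thesis
    by (intro that[OF U]) simp_all
qed

text \<open>The charts composed with \<open>p\<close> take the same value at \<open>v\<close> and at
  \<open>T v\<close>. Hence \<open>T\<close> is locally such a composite followed by the holomorphic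
  inverse \<open>g\<close> of the composite near \<open>T w\<close>.\<close>

lemma deck_transformation_holomorphic:
  assumes S: "oriented_hyperbolic_surface S A" and p: "universal_cover S A p"
    and T: "deck_transformation p T"
  shows "T holomorphic_on hyp_plane"
  unfolding holomorphic_on_def
proof
  fix w assume w: "w \<in> hyp_plane"
  note T' = deck_transformationD[OF T]
  have "p w \<in> S" by (rule universal_cover_in_base[OF p w])
  then obtain U \<phi> where U: "(U, \<phi>) \<in> A" "p w \<in> U"
    and Uo: "openin (top_of_set S) U" and \<phi>H: "\<phi> ` U \<subseteq> hyp_plane"
    and \<phi>: "\<forall>a\<in>U. \<forall>b\<in>U. hyp_dist (\<phi> a) (\<phi> b) = dist a b"
    by (rule oriented_hyperbolic_surface_chart[OF S])
  define M where "M = {v \<in> hyp_plane. p v \<in> U}"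
  have hol: "(\<lambda>v. \<phi> (p v)) holomorphic_on M"
  proof -
    have "\<forall>(U, \<phi>)\<in>A. (\<lambda>w. \<phi> (p w)) holomorphic_on {w \<in> hyp_plane. p w \<in> U}"
      using p by (simp add: universal_cover_def)
    from bspec[OF this U(1)] show ?thesis by (simp add: M_def)
  qed
  have "openin (top_of_set hyp_plane) (hyp_plane \<inter> p -` U)"
    using continuous_openin_preimage[OF covering_space_imp_continuous[OF universal_cover_covering_space[OF p]] _ Uo]
      universal_cover_in_base[OF p] by blast
  then have M: "open M"
    using open_hyp_plane openin_open_trans by (auto simp: M_def Int_def vimage_def)
  obtain N where N: "open N" "T w \<in> N" "N \<subseteq> hyp_plane"
    "\<And>u v. u \<in> N \<Longrightarrow> v \<in> N \<Longrightarrow> dist (p u) (p v) = hyp_dist u v"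
    by (rule universal_cover_local_isometry[OF p T'(4)[OF w]]) (rule that)
  \<comment> \<open>Both \<open>p\<close> on \<open>N\<close> and the chart preserve distances, so
    their composite is injective and has a holomorphic inverse.\<close>
  have inj: "inj_on (\<lambda>v. \<phi> (p v)) (N \<inter> M)"
  proof (rule inj_onI)
    fix u v assume uv: "u \<in> N \<inter> M" "v \<in> N \<inter> M" "\<phi> (p u) = \<phi> (p v)"
    have "hyp_dist u v = hyp_dist (\<phi> (p u)) (\<phi> (p v))"
      using N(4)[of u v] \<phi> uv(1,2) by (auto simp: M_def)
    also have "\<dots> = 0"
      using uv \<phi>H by (auto simp: M_def intro!: hyp_dist_self)
    finally show "u = v" using uv N(3) hyp_dist_eq_0_iff by blast
  qed
  obtain g where g: "g holomorphic_on (\<lambda>v. \<phi> (p v)) ` (N \<inter> M)"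
      "\<And>v. v \<in> N \<inter> M \<Longrightarrow> g (\<phi> (p v)) = v"
    by (rule holomorphic_has_inverse[OF holomorphic_on_subset[OF hol Int_lower2] open_Int[OF N(1) M] inj]) (rule that)
  define Q where "Q = M \<inter> (hyp_plane \<inter> T -` N)"
  have "open Q"
    unfolding Q_def by (intro open_Int M continuous_open_preimage[OF T'(1) open_hyp_plane N(1)])
  have QN: "T v \<in> N \<inter> M" if "v \<in> Q" for v
    using that T'(4,5) by (auto simp: Q_def M_def)
  have "g \<circ> (\<lambda>v. \<phi> (p v)) holomorphic_on Q"
  proof (rule holomorphic_on_compose_gen[OF _ g(1)])
    show "(\<lambda>v. \<phi> (p v)) holomorphic_on Q"
      using hol by (rule holomorphic_on_subset) (auto simp: Q_def)
    show "(\<lambda>v. \<phi> (p v)) ` Q \<subseteq> (\<lambda>v. \<phi> (p v)) ` (N \<inter> M)"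
    proof
      fix y assume "y \<in> (\<lambda>v. \<phi> (p v)) ` Q"
      then obtain v where v: "v \<in> Q" "y = \<phi> (p v)" by blast
      then have "y = \<phi> (p (T v))" using T'(5) by (simp add: Q_def)
      then show "y \<in> (\<lambda>v. \<phi> (p v)) ` (N \<inter> M)" using QN[OF v(1)] by blast
    qed
  qed
  then have "T holomorphic_on Q"
  proof (rule holomorphic_transform)
    fix v assume v: "v \<in> Q"
    then have "p v = p (T v)" using T'(5) by (simp add: Q_def)
    then show "(g \<circ> (\<lambda>v. \<phi> (p v))) v = T v" using g(2)[OF QN[OF v]] by simp
  qed
  moreover have "w \<in> Q" using w U(2) N(2) by (simp add: Q_def M_def)
  ultimately have "T field_differentiable at w"
    using \<open>open Q\<close> by (meson holomorphic_on_imp_differentiable_at)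
  then show "T field_differentiable (at w within hyp_plane)"
    by (rule field_differentiable_at_within)
qed

lemma deck_transformation_orientation_preserving_isometry:
  assumes "oriented_hyperbolic_surface S A" "universal_cover S A p" "deck_transformation p T"
  shows "orientation_preserving_isometry T"
  unfolding orientation_preserving_isometry_def
  using deck_transformation_holomorphic[OF assms] deck_transformation_isometry[OF assms(2,3)]
    deck_transformationD[OF assms(3)]
  by (simp add: bij_betw_def)

text \<open>\<open>T \<circ> \<alpha>\<close> and the shifted line lift the same curve and agree at
  0, so they agree everywhere.\<close>

lemma deck_transformation_directed_axis:
  assumes p: "universal_cover S A p" and T: "deck_transformation p T" and "l > 0"
    and \<alpha>: "geodesic_line \<alpha>" and per: "\<And>t. p (\<alpha> (t + l)) = p (\<alpha> t)" and 0: "T (\<alpha> 0) = \<alpha> l"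
  shows "directed_axis T l \<alpha>"
proof -
  note H = geodesic_line_hyp_plane[OF \<alpha>] and \<alpha>c = continuous_on_geodesic_line[OF \<alpha>]
  note T' = deck_transformationD[OF T]
  have "T (\<alpha> t) = \<alpha> (t + l)" for t
  proof (rule covering_space_lift_unique[OF universal_cover_covering_space[OF p],
        of "\<lambda>t. T (\<alpha> t)" 0 "\<lambda>t. \<alpha> (t + l)" UNIV "\<lambda>t. p (\<alpha> t)" t])
    show "continuous_on UNIV (\<lambda>t. p (\<alpha> t))"
      by (rule continuous_on_compose2[OF covering_space_imp_continuous[OF universal_cover_covering_space[OF p]] \<alpha>c])
         (use H in blast)
    show "continuous_on UNIV (\<lambda>t. T (\<alpha> t))"
      by (rule continuous_on_compose2[OF T'(1) \<alpha>c]) (use H in blast)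
    show "continuous_on UNIV (\<lambda>t. \<alpha> (t + l))"
      by (rule continuous_on_compose2[OF \<alpha>c[of UNIV]]) (auto intro!: continuous_intros)
  qed (use H T' 0 per universal_cover_in_base[OF p] in auto)
  then show ?thesis
    using \<alpha> \<open>l > 0\<close> by (simp add: directed_axis_def)
qed

lemma closed_geodesic_of_directed_axis:
  assumes p: "universal_cover S A p" and T: "deck_transformation p T" and ax: "directed_axis T l \<alpha>"
  shows "closed_geodesic S l (p \<circ> \<alpha>)"
  unfolding closed_geodesic_def
proof (intro conjI allI)
  have \<alpha>: "geodesic_line \<alpha>" and l: "l > 0" "\<And>t. T (\<alpha> t) = \<alpha> (t + l)"
    using ax by (auto simp: directed_axis_def)
  note H = geodesic_line_hyp_plane[OF \<alpha>]
  show "l > 0" by (rule l)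
  have \<alpha>H: "range \<alpha> \<subseteq> hyp_plane" using H by blast
  show "range (p \<circ> \<alpha>) \<subseteq> S" using H universal_cover_in_base[OF p] by auto
  fix t
  show "(p \<circ> \<alpha>) (t + l) = (p \<circ> \<alpha>) t"
    using deck_transformationD(5)[OF T H] by (simp flip: l(2))
  obtain e where e: "e > 0" "\<And>s s'. s \<in> {t-e<..<t+e} \<Longrightarrow> s' \<in> {t-e<..<t+e} \<Longrightarrow>
      dist (p (\<alpha> s)) (p (\<alpha> s')) = hyp_dist (\<alpha> s) (\<alpha> s')"
    by (rule universal_cover_local_isometry_path[OF p continuous_on_geodesic_line[OF \<alpha>] \<alpha>H, where t = t]) (rule that)
  then show "\<exists>e>0. \<forall>s\<in>{t-e<..<t+e}. \<forall>s'\<in>{t-e<..<t+e}. dist ((p \<circ> \<alpha>) s) ((p \<circ> \<alpha>) s') = \<bar>s - s'\<bar>"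
    by (intro exI[of _ e]) (simp add: geodesic_line_dist[OF \<alpha>])
qed

section \<open>Free homotopy classes and deck transformations\<close>

lemma homotopic_loops_deck_transformation:
  assumes p: "universal_cover S A p" and T: "deck_transformation p T"
    and g: "path g" "path_image g \<subseteq> hyp_plane" "pathfinish g = T (pathstart g)"
    and h: "path h" "path_image h \<subseteq> hyp_plane" "pathfinish h = T (pathstart h)"
  shows "homotopic_loops S (p \<circ> g) (p \<circ> h)"
proof -
  note T' = deck_transformationD[OF T]
  define c where "c = linepath (pathstart g) (pathstart h)"
  have ends: "pathstart g \<in> hyp_plane" "pathstart h \<in> hyp_plane"
    using g h by (auto dest: pathstart_in_path_image[THEN subsetD[rotated]])
  have c: "path c" "path_image c \<subseteq> hyp_plane"
    using convex_contains_segment[of hyp_plane] convex_hyp_plane ends by (auto simp: c_def)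
  have Tc: "path (T \<circ> c)" "path_image (T \<circ> c) \<subseteq> hyp_plane"
    using c T'(1,4) by (auto intro: path_continuous_image continuous_on_subset simp: path_image_compose)
  have pc: "continuous_on hyp_plane p"
    using covering_space_imp_continuous[OF universal_cover_covering_space[OF p]] .
  have pS: "p \<in> hyp_plane \<rightarrow> S" using universal_cover_in_base[OF p] by blast
  have path_p: "path (p \<circ> q)" "path_image (p \<circ> q) \<subseteq> S" if "path q" "path_image q \<subseteq> hyp_plane" for q
    using that pc pS by (auto intro: path_continuous_image continuous_on_subset simp: path_image_compose)
  have joins: "pathfinish c = pathstart h" "pathfinish h = pathstart (reversepath (T \<circ> c))"
      "pathstart c = pathstart g" "pathfinish (T \<circ> c) = T (pathstart h)" "pathstart (T \<circ> c) = T (pathstart g)"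
    by (simp_all add: c_def h pathfinish_compose pathstart_compose)
  \<comment> \<open>The plane is simply connected, so \<open>g\<close> may be deformed to the detour
    along \<open>c\<close>, \<open>h\<close> and back along \<open>T \<circ> c\<close>. Below,
    \<open>c\<close> and \<open>T \<circ> c\<close> have the same projection, which leaves a
    conjugate of \<open>p \<circ> h\<close>.\<close>
  have "homotopic_paths hyp_plane g (c +++ h +++ reversepath (T \<circ> c))"
  proof -
    have "path (c +++ h +++ reversepath (T \<circ> c))"
      using c h Tc joins by simp
    moreover have "path_image (c +++ h +++ reversepath (T \<circ> c)) \<subseteq> hyp_plane"
      using c h Tc by (intro subset_path_image_join) auto
    moreover have "simply_connected hyp_plane"
      using convex_hyp_plane by (rule convex_imp_simply_connected)
    ultimately show ?thesis
      using g joins unfolding simply_connected_eq_homotopic_paths by simp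
  qed
  then have "homotopic_paths S (p \<circ> g) (p \<circ> (c +++ h +++ reversepath (T \<circ> c)))"
    using pc pS by (rule homotopic_paths_continuous_image)
  then have "homotopic_loops S (p \<circ> g) (p \<circ> (c +++ h +++ reversepath (T \<circ> c)))"
    using g joins T'(5)[OF ends(1)]
    by (intro homotopic_paths_imp_homotopic_loops) (simp_all add: pathfinish_compose pathstart_compose)
  moreover have "homotopic_loops S (p \<circ> (c +++ h +++ reversepath (T \<circ> c)))
      ((p \<circ> c) +++ (p \<circ> h) +++ reversepath (p \<circ> c))"
  proof (rule homotopic_loops_eq)
    have 1: "path (c +++ h +++ reversepath (T \<circ> c))"
      "path_image (c +++ h +++ reversepath (T \<circ> c)) \<subseteq> hyp_plane"
      using c h Tc joins by (simp_all add: subset_path_image_join)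
    show "path (p \<circ> (c +++ h +++ reversepath (T \<circ> c)))"
      "path_image (p \<circ> (c +++ h +++ reversepath (T \<circ> c))) \<subseteq> S"
      using path_p[OF 1] by auto
    show "pathfinish (p \<circ> (c +++ h +++ reversepath (T \<circ> c)))
        = pathstart (p \<circ> (c +++ h +++ reversepath (T \<circ> c)))"
      using joins T'(5)[OF ends(1)] by (simp add: pathfinish_compose pathstart_compose)
    fix t :: real assume t: "t \<in> {0..1}"
    have "p (T (c s)) = p (c s)" if "s \<in> {0..1}" for s
      using that c(2) by (intro T'(5)) (auto simp: path_image_def)
    then show "(p \<circ> (c +++ h +++ reversepath (T \<circ> c))) t = ((p \<circ> c) +++ (p \<circ> h) +++ reversepath (p \<circ> c)) t"
      using t by (auto simp: joinpaths_def reversepath_def)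
  qed
  moreover have "homotopic_loops S ((p \<circ> c) +++ (p \<circ> h) +++ reversepath (p \<circ> c)) (p \<circ> h)"
    using path_p[OF c] path_p[OF h(1,2)] h(3) T'(5)[OF ends(2)] joins(1)
    by (intro homotopic_loops_conjugate_metric) (auto simp: pathfinish_compose pathstart_compose)
  ultimately show ?thesis using homotopic_loops_trans by blast
qed

lemma homotopic_loops_lift:
  assumes p: "universal_cover S A p" and T: "deck_transformation p T"
    and g: "path g" "path_image g \<subseteq> hyp_plane" "pathfinish g = T (pathstart g)"
    and hom: "homotopic_loops S (p \<circ> g) \<delta>"
  obtains k where "path k" "path_image k \<subseteq> hyp_plane" "pathfinish k = T (pathstart k)"
    "\<And>t. t \<in> {0..1} \<Longrightarrow> p (k t) = \<delta> t"
proof -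
  note T' = deck_transformationD[OF T] and cov = universal_cover_covering_space[OF p]
  obtain h where h: "continuous_on ({0..1::real} \<times> {0..1::real}) h" "h \<in> ({0..1} \<times> {0..1}) \<rightarrow> S"
      "\<And>x. x \<in> {0..1} \<Longrightarrow> h (0, x) = (p \<circ> g) x" "\<And>x. x \<in> {0..1} \<Longrightarrow> h (1, x) = \<delta> x"
      "\<And>t. t \<in> {0..1} \<Longrightarrow> h (t, 1) = h (t, 0)"
    using hom unfolding homotopic_loops by (auto simp: pathfinish_def pathstart_def)
  obtain k where k: "continuous_on ({0..1} \<times> {0..1}) k" "k \<in> ({0..1} \<times> {0..1}) \<rightarrow> hyp_plane"
      "\<And>y. y \<in> {0..1} \<Longrightarrow> k (0, y) = g y" "\<And>z. z \<in> {0..1} \<times> {0..1} \<Longrightarrow> p (k z) = h z"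
  proof (rule covering_space_lift_homotopy_metric[OF cov h(1,2)])
    show "h (0, y) = p (g y)" if "y \<in> {0..1}" for y using h(3)[OF that] by simp
    show "continuous_on {0..1} g" "g \<in> {0..1} \<rightarrow> hyp_plane"
      using g by (auto simp: path_def path_image_def)
  qed (rule that)
  have kt: "continuous_on {0..1} (\<lambda>s. k (s, t))" if "t \<in> {0..1}" for t
    by (rule continuous_on_compose2[OF k(1)]) (use that in \<open>auto intro!: continuous_intros\<close>)
  have kH: "k (s, t) \<in> hyp_plane" if "s \<in> {0..1}" "t \<in> {0..1}" for s t
    using k(2) that by auto
  \<comment> \<open>The two vertical sides of the lifted square project to the track of the base
    point. One side and the \<open>T\<close>-image of the other agree at the start, because
    \<open>g\<close> ends at the \<open>T\<close>-image of its starting point, hence also at the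
    end.\<close>
  have "k (1, 1) = T (k (1, 0))"
  proof (rule covering_space_lift_unique[OF cov,
        of "\<lambda>s. k (s, 1)" 0 "\<lambda>s. T (k (s, 0))" "{0..1}" "\<lambda>s. h (s, 0)" 1])
    show "k (0, 1) = T (k (0, 0))" using g(3) by (simp add: k(3) pathfinish_def pathstart_def)
    show "continuous_on {0..1} (\<lambda>s. h (s, 0))"
      by (rule continuous_on_compose2[OF h(1)]) (auto intro!: continuous_intros)
    show "continuous_on {0..1} (\<lambda>s. T (k (s, 0)))"
      by (rule continuous_on_compose2[OF T'(1) kt]) (use kH in auto)
    show "(\<lambda>s. h (s, 0)) \<in> {0..1} \<rightarrow> S" using h(2) by auto
    show "(\<lambda>s. k (s, 1)) \<in> {0..1} \<rightarrow> hyp_plane" "(\<lambda>s. T (k (s, 0))) \<in> {0..1} \<rightarrow> hyp_plane"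
      using kH T'(4) by auto
    show "h (s, 0) = p (k (s, 1))" if "s \<in> {0..1}" for s
      using k(4)[of "(s, 1)"] h(5)[OF that] that by simp
    show "h (s, 0) = p (T (k (s, 0)))" if "s \<in> {0..1}" for s
      using k(4)[of "(s, 0)"] T'(5)[OF kH] that by simp
  qed (use kt in auto)
  moreover have "path (\<lambda>t. k (1, t))"
    unfolding path_def by (rule continuous_on_compose2[OF k(1)]) (auto intro!: continuous_intros)
  ultimately show ?thesis
    using kH k(4) h(4)
    by (intro that[of "\<lambda>t. k (1, t)"]) (auto simp: path_image_def pathfinish_def pathstart_def)
qed

lemma pathfinish_lift_of_loop:
  assumes p: "universal_cover S A p" and \<alpha>: "geodesic_line \<alpha>" and k: "path k" "path_image k \<subseteq> hyp_plane"
    and eq: "\<And>t. t \<in> {0..1} \<Longrightarrow> p (k t) = p (\<alpha> (l * t))" and 0: "\<alpha> 0 = pathstart k"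
  shows "pathfinish k = \<alpha> l"
proof -
  note H = geodesic_line_hyp_plane[OF \<alpha>] and cov = universal_cover_covering_space[OF p]
  have \<alpha>c: "continuous_on {0..1} (\<lambda>t. \<alpha> (l * t))"
    by (rule continuous_on_compose2[OF continuous_on_geodesic_line[OF \<alpha>, of UNIV]])
       (auto intro!: continuous_intros)
  have "k 1 = \<alpha> (l * 1)"
  proof (rule covering_space_lift_unique[OF cov, of k 0 "\<lambda>t. \<alpha> (l * t)" "{0..1}" "\<lambda>t. p (\<alpha> (l * t))" 1])
    show "continuous_on {0..1} (\<lambda>t. p (\<alpha> (l * t)))"
      by (rule continuous_on_compose2[OF covering_space_imp_continuous[OF cov] \<alpha>c]) (use H in blast)
  qed (use k eq 0 H \<alpha>c universal_cover_in_base[OF p] in \<open>auto simp: path_def path_image_def pathstart_def\<close>)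
  then show ?thesis by (simp add: pathfinish_def)
qed

lemma unique_closed_geodesic_of_directed_axis:
  assumes S: "oriented_hyperbolic_surface S A" and p: "universal_cover S A p"
    and T: "deck_transformation p T" and ax: "directed_axis T l \<alpha>"
    and g: "path g" "path_image g \<subseteq> hyp_plane" "pathfinish g = T (pathstart g)"
  shows "unique_closed_geodesic_in_class S (p \<circ> g) l (p \<circ> \<alpha>)"
  unfolding unique_closed_geodesic_in_class_def
proof (intro conjI allI impI)
  have \<alpha>: "geodesic_line \<alpha>" and l: "\<And>t. T (\<alpha> t) = \<alpha> (t + l)"
    using ax by (auto simp: directed_axis_def)
  note H = geodesic_line_hyp_plane[OF \<alpha>]
  show "closed_geodesic S l (p \<circ> \<alpha>)"
    by (rule closed_geodesic_of_directed_axis[OF p T ax])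
  have "path (\<lambda>t. \<alpha> (l * t))"
    unfolding path_def
    by (rule continuous_on_compose2[OF continuous_on_geodesic_line[OF \<alpha>, of UNIV]])
       (auto intro!: continuous_intros)
  moreover have "path_image (\<lambda>t. \<alpha> (l * t)) \<subseteq> hyp_plane"
    using H by (auto simp: path_image_def)
  moreover have "pathfinish (\<lambda>t. \<alpha> (l * t)) = T (pathstart (\<lambda>t. \<alpha> (l * t)))"
    by (simp add: pathfinish_def pathstart_def l)
  ultimately have "homotopic_loops S (p \<circ> g) (p \<circ> (\<lambda>t. \<alpha> (l * t)))"
    using homotopic_loops_deck_transformation[OF p T g] by blast
  then show "homotopic_loops S (p \<circ> g) (geodesic_loop l (p \<circ> \<alpha>))"
    by (simp add: geodesic_loop_def comp_def)
  fix l' z' assume z': "closed_geodesic S l' z' \<and> homotopic_loops S (p \<circ> g) (geodesic_loop l' z')"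
  \<comment> \<open>Lifting the homotopy, rather than just the competing loop, gives a lift whose
    ends are related by \<open>T\<close> itself and not by some conjugate. It covers one period;
    \<open>\<beta>\<close> below extends it to a line.\<close>
  obtain k where k: "path k" "path_image k \<subseteq> hyp_plane" "pathfinish k = T (pathstart k)"
      "\<And>t. t \<in> {0..1} \<Longrightarrow> p (k t) = geodesic_loop l' z' t"
    using homotopic_loops_lift[OF p T g] z' by blast
  have "pathstart k \<in> hyp_plane" "p (pathstart k) = z' 0"
    using k(2) k(4)[of 0] by (auto simp: path_image_def pathstart_def geodesic_loop_def)
  then obtain \<beta> where \<beta>: "geodesic_line \<beta>" "\<beta> 0 = pathstart k" "\<And>t. p (\<beta> t) = z' t"
    using closed_geodesic_lift[OF p] z' by metis
  have "pathfinish k = \<beta> l'"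
    using pathfinish_lift_of_loop[OF p \<beta>(1) k(1,2)] k(4) \<beta>(2,3) by (simp add: geodesic_loop_def)
  then have "directed_axis T l' \<beta>"
    using z' k(3) \<beta>
    by (intro deck_transformation_directed_axis[OF p T _ \<beta>(1)]) (auto simp: closed_geodesic_def)
  then have "l' = l" "\<exists>s. \<forall>t. \<beta> t = \<alpha> (t + s)"
    using directed_axis_unique[OF deck_transformation_holomorphic[OF S p T] ax] by blast+
  then show "same_closed_geodesic l (p \<circ> \<alpha>) l' z'"
    unfolding same_closed_geodesic_def by (metis \<beta>(3) comp_apply)
qed

lemma directed_axis_of_closed_geodesic:
  assumes p: "universal_cover S A p" and z: "closed_geodesic S l z"
    and w: "w \<in> hyp_plane" "p w = z 0" and T: "deck_transformation_of_loop p w (geodesic_loop l z) T"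
  obtains \<zeta> where "directed_axis T l \<zeta>" "\<zeta> 0 = w" "\<And>t. p (\<zeta> t) = z t"
proof -
  obtain \<zeta> where \<zeta>: "geodesic_line \<zeta>" "\<zeta> 0 = w" "\<And>t. p (\<zeta> t) = z t"
    using closed_geodesic_lift[OF p z w] by metis
  obtain g where T': "deck_transformation p T" and
      g: "path g" "path_image g \<subseteq> hyp_plane" "pathstart g = w"
      "\<And>t. t \<in> {0..1} \<Longrightarrow> p (g t) = geodesic_loop l z t" "T w = pathfinish g"
    using T unfolding deck_transformation_of_loop_def by blast
  have "pathfinish g = \<zeta> l"
    using pathfinish_lift_of_loop[OF p \<zeta>(1) g(1,2)] g(3,4) \<zeta> by (simp add: geodesic_loop_def)
  then have "directed_axis T l \<zeta>"
    using z g(5) \<zeta>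
    by (intro deck_transformation_directed_axis[OF p T' _ \<zeta>(1)]) (auto simp: closed_geodesic_def)
  then show ?thesis using that \<zeta> by blast
qed

text \<open>Reversal negates the tangent vector, and two opposite vectors span at most a real
  line.\<close>

lemma transversal_at_not_reverse:
  assumes "transversal_at A x y P"
  shows "\<not> (\<forall>t. y t = x (- t))"
proof
  assume rev: "\<forall>t. y t = x (- t)"
  obtain U \<phi> v w where v: "((\<phi> \<circ> x) has_vector_derivative v) (at 0)"
    and w: "((\<phi> \<circ> y) has_vector_derivative w) (at 0)" and span: "span {v, w} = (UNIV :: complex set)"
    using assms unfolding transversal_at_def by blast
  have "((\<phi> \<circ> x) \<circ> uminus has_vector_derivative (-1) *\<^sub>R v) (at 0)"
    by (rule vector_diff_chain_at) (use v in \<open>auto intro!: derivative_eq_intros\<close>)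
  moreover have "(\<phi> \<circ> x) \<circ> uminus = \<phi> \<circ> y"
    using rev by auto
  ultimately have "w = - v"
    using w vector_derivative_unique_at by fastforce
  then have "span {v, w} \<subseteq> span {v}"
    by (intro span_minimal) (auto intro: span_base span_neg)
  then have "dim (UNIV :: complex set) \<le> dim (span {v})"
    using span dim_subset by metis
  also have "\<dots> \<le> card {v}" by (simp add: dim_le_card')
  finally show False by simp
qed

theorem corollary3p2:
  fixes S :: "'a::metric_space set"
    and A :: "('a set \<times> ('a \<Rightarrow> complex)) set"
    and p :: "complex \<Rightarrow> 'a"
    and x y :: "real \<Rightarrow> 'a"
    and lx ly :: real
    and P :: 'a
    and P' :: complex
    and X Y :: "complex \<Rightarrow> complex"
  assumes "oriented_hyperbolic_surface S A"
    and "complete S"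
    and "surface_euler_char (top_of_set S) < 0"
    and "universal_cover S A p"
    and "closed_geodesic S lx x"
    and "closed_geodesic S ly y"
    and "transversal_at A x y P"
    and "P' \<in> hyp_plane" and "p P' = P"
    and "deck_transformation_of_loop p P' (geodesic_loop lx x) X"
    and "deck_transformation_of_loop p P' (geodesic_loop ly y) Y"
  shows "hyperbolic_isometry (X \<circ> Y) \<and>
    (\<forall>l \<alpha>. directed_axis (X \<circ> Y) l \<alpha> \<longrightarrow>
       unique_closed_geodesic_in_class S (geodesic_loop lx x +++ geodesic_loop ly y) l (p \<circ> \<alpha>) \<and>
       geodesic_midpoint lx x \<in> range (p \<circ> \<alpha>) \<inter> range x \<and>
       geodesic_midpoint ly y \<in> range (p \<circ> \<alpha>) \<inter> range y)"
proof -
  note S = assms(1) and p = assms(4)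
  have X: "deck_transformation p X" and Y: "deck_transformation p Y"
    using assms(10,11) by (auto simp: deck_transformation_of_loop_def)
  note XY = deck_transformation_compose[OF X Y]
  have P: "p P' = x 0" "p P' = y 0"
    using assms(7,9) by (auto simp: transversal_at_def)
  obtain \<xi> where \<xi>: "directed_axis X lx \<xi>" "\<xi> 0 = P'" "\<And>t. p (\<xi> t) = x t"
    using directed_axis_of_closed_geodesic[OF p assms(5,8) P(1) assms(10)] by metis
  obtain \<eta> where \<eta>: "directed_axis Y ly \<eta>" "\<eta> 0 = P'" "\<And>t. p (\<eta> t) = y t"
    using directed_axis_of_closed_geodesic[OF p assms(6,8) P(2) assms(11)] by metis
  have g: "geodesic_line \<xi>" "geodesic_line \<eta>" and lxy: "lx > 0" "ly > 0"
    and X\<xi>: "\<And>t. X (\<xi> t) = \<xi> (t + lx)" and Y\<eta>: "\<And>t. Y (\<eta> t) = \<eta> (t + ly)"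
    using \<xi>(1) \<eta>(1) by (auto simp: directed_axis_def)
  note H = geodesic_line_hyp_plane[OF g(1)] geodesic_line_hyp_plane[OF g(2)]
  \<comment> \<open>Coinciding midpoints are equally far from \<open>P'\<close>, so
    \<open>lx = ly\<close>; then \<open>\<xi>\<close> and the reversed \<open>\<eta>\<close> share
    two points and are equal.\<close>
  have ne: "\<xi> (lx / 2) \<noteq> \<eta> (- (ly / 2))"
  proof
    assume eq: "\<xi> (lx / 2) = \<eta> (- (ly / 2))"
    then have "lx = ly"
      using geodesic_line_dist[OF g(1), of 0 "lx / 2"] geodesic_line_dist[OF g(2), of 0 "- (ly / 2)"]
        \<xi>(2) \<eta>(2) lxy by simp
    then have "\<xi> = (\<lambda>t. \<eta> (- t))"
      using geodesic_line_unique[OF g(1) geodesic_line_reverse[OF g(2)], of 0 "lx / 2"] eq \<xi>(2) \<eta>(2) lxy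
      by simp
    then have "\<xi> (- t) = \<eta> t" for t by simp
    then have "y t = x (- t)" for t using \<xi>(3)[of "- t"] \<eta>(3)[of t] by simp
    then show False using transversal_at_not_reverse[OF assms(7)] by blast
  qed
  have P0: "\<xi> 0 = \<eta> 0" by (simp add: \<xi> \<eta>)
  obtain m \<beta> where \<beta>: "directed_axis (X \<circ> Y) m \<beta>" "\<beta> 0 = \<eta> (- (ly / 2))" "\<beta> (m / 2) = \<xi> (lx / 2)"
    using directed_axis_compose[OF deck_transformation_holomorphic[OF S p X] \<xi>(1)
        deck_transformation_holomorphic[OF S p Y] \<eta>(1) P0 ne] by metis
  \<comment> \<open>The lift of the product loop from \<open>P'\<close>: the part over
    \<open>y\<close> starts at \<open>X P'\<close> and is therefore the \<open>X\<close>-image of a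
    piece of \<open>\<eta>\<close>. It ends at \<open>X (Y P')\<close>.\<close>
  define c where "c = (\<lambda>t. \<xi> (lx * t)) +++ (\<lambda>t. X (\<eta> (ly * t)))"
  have "path (\<lambda>t. \<xi> (lx * t))" "path (\<lambda>t. \<eta> (ly * t))"
    unfolding path_def
    by (rule continuous_on_compose2[OF continuous_on_geodesic_line[of _ UNIV]];
        auto intro!: continuous_intros g)+
  moreover from this(2) have "path (\<lambda>t. X (\<eta> (ly * t)))"
    unfolding path_def
    by (rule continuous_on_compose2[OF deck_transformationD(1)[OF X]]) (use H in blast)
  ultimately have "path c"
    using X\<xi>[of 0] P0 by (auto simp: c_def pathstart_def pathfinish_def intro!: path_join_imp)
  moreover have "path_image c \<subseteq> hyp_plane"
    unfolding c_def using H deck_transformationD(4)[OF X]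
    by (intro subset_path_image_join) (auto simp: path_image_def)
  moreover have "pathfinish c = (X \<circ> Y) (pathstart c)"
    using Y\<eta>[of 0] P0 by (simp add: c_def pathstart_def pathfinish_def joinpaths_def)
  ultimately have c: "path c" "path_image c \<subseteq> hyp_plane" "pathfinish c = (X \<circ> Y) (pathstart c)"
    by auto
  have pc: "p \<circ> c = geodesic_loop lx x +++ geodesic_loop ly y"
    unfolding c_def path_compose_join
    by (simp add: geodesic_loop_def comp_def \<xi> \<eta> deck_transformationD(5)[OF X H(2)])
  show ?thesis
  proof (intro conjI allI impI)
    show "hyperbolic_isometry (X \<circ> Y)"
      unfolding hyperbolic_isometry_def
      using deck_transformation_orientation_preserving_isometry[OF S p XY] \<beta>(1) by blast
    fix l \<alpha> assume ax: "directed_axis (X \<circ> Y) l \<alpha>"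
    show "unique_closed_geodesic_in_class S (geodesic_loop lx x +++ geodesic_loop ly y) l (p \<circ> \<alpha>)"
      using unique_closed_geodesic_of_directed_axis[OF S p XY ax c] by (simp only: pc)
    obtain s where s: "\<And>t. \<beta> t = \<alpha> (t + s)"
      using directed_axis_unique(2)[OF deck_transformation_holomorphic[OF S p XY] ax \<beta>(1)] by blast
    have "geodesic_midpoint lx x = (p \<circ> \<alpha>) (m / 2 + s)"
      unfolding geodesic_midpoint_def by (simp flip: s) (simp add: \<beta> \<xi>)
    moreover have "geodesic_midpoint lx x \<in> range x" by (simp add: geodesic_midpoint_def)
    ultimately show "geodesic_midpoint lx x \<in> range (p \<circ> \<alpha>) \<inter> range x"
      by (metis IntI rangeI)
    \<comment> \<open>The axis passes through the point of \<open>\<eta>\<close> half a period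
      behind \<open>P'\<close>, while the midpoint is defined half a period ahead; both have the
      same projection.\<close>
    have "y (- (ly / 2) + ly) = y (- (ly / 2))"
      using assms(6) unfolding closed_geodesic_def by blast
    then have "geodesic_midpoint ly y = p (\<beta> 0)"
      by (simp add: geodesic_midpoint_def \<beta> \<eta>)
    then have "geodesic_midpoint ly y = (p \<circ> \<alpha>) (0 + s)"
      by (simp only: s comp_apply)
    moreover have "geodesic_midpoint ly y \<in> range y" by (simp add: geodesic_midpoint_def)
    ultimately show "geodesic_midpoint ly y \<in> range (p \<circ> \<alpha>) \<inter> range y"
      by (metis IntI rangeI)
  qed
qed

end
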